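(* (i) Let $n\ge 1$ and let $f:(\mathbb{R}^n,0)\to(\mathbb{R}^n,0)$ be an $n$-Morin singularity. Then the $\mathcal{A}$-orbit $\mathcal{A}(f)$ of $f$ consists of exactly four $\mathcal{A}$-isotopy classes if $n$ is divisible by $4$, and of exactly two $\mathcal{A}$-isotopy classes if $n$ is not divisible by $4$. (ii) Let $1\le k<n$ and let $f:(\mathbb{R}^n,0)\to(\mathbb{R}^n,0)$ be a $k$-Morin singularity. Then $\mathcal{A}(f)$ consists of exactly two $\mathcal{A}$-isotopy classes if $k$ is even, and of exactly one $\mathcal{A}$-isotopy class if $k$ is odd.
   Context: All germs are $C^\infty$, and $C^\infty(m,n)$ denotes the set of map-germs $(\mathbb{R}^m,0)\to(\mathbb{R}^n,0)$. Two germs $f,g\in C^\infty(m,n)$ are $\mathcal{A}$-equivalent if $g=\tau\circ f\circ\sigma$ for diffeomorphism-germs $\sigma$ of $(\mathbb{R}^m,0)$ and $\tau$ of $(\mathbb{R}^n,0)$; $\mathcal{A}(f)$ is the $\mathcal{A}$-equivalence class (orbit) of $f$. A germ $f$ is $r$-determined if every $g$ with the same $r$-jet at $0$ is $\mathcal{A}$-equivalent to $f$. Let $f,g\in C^\infty(m,n)$ be $\mathcal{A}$-equivalent and $r$-determined. They are $\mathcal{A}$-isotopic if there exist continuous curves $\sigma:[0,1]\to \mathrm{Diff}^r(m)$ and $\tau:[0,1]\to\mathrm{Diff}^r(n)$ with $\sigma(0),\tau(0)$ the identity and $j^rg(0)=j^r(\tau(1)\circ f\circ\sigma(1))(0)$,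 where $\mathrm{Diff}^r(m)$ is the space of $r$-jets at $0$ of diffeomorphism-germs $(\mathbb{R}^m,0)\to(\mathbb{R}^m,0)$. Equivalently, there are orientation-preserving diffeomorphism-germs $\sigma^+$, $\tau^+$ of source and target with $j^rg(0)=j^r(\tau^+\circ f\circ\sigma^+)(0)$. For $1\le k\le n$, a germ $f\in C^\infty(n,n)$ is a $k$-Morin singularity if it is $\mathcal{A}$-equivalent to $(x_1,\dots,x_n)\mapsto(x_1x_2+x_1^2x_3+\cdots+x_1^{k-1}x_k+x_1^{k+1},\,x_2,\dots,x_n)$ (for $k=1$: $(x_1^2,x_2,\dots,x_n)$). A $k$-Morin singularity is $(k+1)$-determined. *)

theory Defs
  imports "HOL-Analysis.Analysis"
begin

(* iter_deriv f [v1, ..., vl] = D_v1 (... (D_vl f)), iterated directional derivatives. *)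
primrec iter_deriv ::
  "('a::real_normed_vector \<Rightarrow> 'b::real_normed_vector) \<Rightarrow> 'a list \<Rightarrow> 'a \<Rightarrow> 'b" where
  "iter_deriv f [] = f"
| "iter_deriv f (v # vs) = (\<lambda>x. frechet_derivative (iter_deriv f vs) (at x) v)"

(* Intended for open S only, where this says that f is infinitely differentiable on S. *)
definition smooth_on ::
  "'a::real_normed_vector set \<Rightarrow> ('a \<Rightarrow> 'b::real_normed_vector) \<Rightarrow> bool" where
  "smooth_on S f \<longleftrightarrow> (\<forall>vs. \<forall>x\<in>S. iter_deriv f vs differentiable (at x))"

(* A map-germ at 0 is given by any of its representatives, a total function whose values
   away from 0 are irrelevant.  All notions below are invariant under changing functions
   outside a neighbourhood of 0; equality of germs is eventual equality in "nhds 0". *)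
definition smooth_germs :: "('a::real_normed_vector \<Rightarrow> 'b::real_normed_vector) set" where
  "smooth_germs = {f. f 0 = 0 \<and> (\<exists>U. open U \<and> 0 \<in> U \<and> smooth_on U f)}"

definition diffeo_germs :: "('a::real_normed_vector \<Rightarrow> 'a) set" where
  "diffeo_germs = {\<phi> \<in> smooth_germs. \<exists>\<psi>\<in>smooth_germs.
     (\<forall>\<^sub>F x in nhds 0. \<psi> (\<phi> x) = x) \<and> (\<forall>\<^sub>F x in nhds 0. \<phi> (\<psi> x) = x)}"

definition A_equivalent ::
  "('a::real_normed_vector \<Rightarrow> 'b::real_normed_vector) \<Rightarrow> ('a \<Rightarrow> 'b) \<Rightarrow> bool" where
  "A_equivalent f g \<longleftrightarrow> f \<in> smooth_germs \<and> g \<in> smooth_germs \<and>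
     (\<exists>\<sigma>\<in>diffeo_germs. \<exists>\<tau>\<in>diffeo_germs. \<forall>\<^sub>F x in nhds 0. g x = \<tau> (f (\<sigma> x)))"

definition A_orbit ::
  "('a::real_normed_vector \<Rightarrow> 'b::real_normed_vector) \<Rightarrow> ('a \<Rightarrow> 'b) set" where
  "A_orbit f = {g. A_equivalent f g}"

(* The r-jet at 0, encoded as the family of all partial derivatives at 0 of order at most r
   (lists of basis vectors of length at most r, padded by 0 elsewhere).  Only finitely many
   coordinates are not identically 0, so the product topology on the function type
   'a list => 'b induces the usual Euclidean topology on the space of r-jets. *)
definition jet ::
  "nat \<Rightarrow> ('a::euclidean_space \<Rightarrow> 'b::real_normed_vector) \<Rightarrow> 'a list \<Rightarrow> 'b" where
  "jet r f = (\<lambda>vs. if length vs \<le> r \<and> set vs \<subseteq> Basis then iter_deriv f vs 0 else 0)"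

definition Diff_jets :: "nat \<Rightarrow> ('a::euclidean_space list \<Rightarrow> 'a) set" where
  "Diff_jets r = jet r ` diffeo_germs"

(* S and T are representatives of the end points of the curves of jets; the r-jet of
   T o f o S depends only on the r-jets of S and T.  The notion is meant for germs that are
   r-determined. *)
definition A_isotopic ::
  "nat \<Rightarrow> ('a::euclidean_space \<Rightarrow> 'b::euclidean_space) \<Rightarrow> ('a \<Rightarrow> 'b) \<Rightarrow> bool" where
  "A_isotopic r f g \<longleftrightarrow> A_equivalent f g \<and>
     (\<exists>\<sigma> \<tau>.
        path \<sigma> \<and> path_image \<sigma> \<subseteq> Diff_jets r \<and> pathstart \<sigma> = jet r (\<lambda>x. x) \<and>
        path \<tau> \<and> path_image \<tau> \<subseteq> Diff_jets r \<and> pathstart \<tau> = jet r (\<lambda>y. y) \<and>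
        (\<exists>S\<in>diffeo_germs. \<exists>T\<in>diffeo_germs.
           jet r S = pathfinish \<sigma> \<and> jet r T = pathfinish \<tau> \<and>
           jet r g = jet r (\<lambda>x. T (f (S x)))))"

definition A_isotopy_classes ::
  "nat \<Rightarrow> ('a::euclidean_space \<Rightarrow> 'b::euclidean_space) \<Rightarrow> ('a \<Rightarrow> 'b) set set" where
  "A_isotopy_classes r f = A_orbit f // {(g, h). A_isotopic r g h}"

(* coord i, for 1 <= i <= CARD('n), is the i-th element of the index type 'n, so that the
   coordinates x_1, ..., x_n of x are x $ coord 1, ..., x $ coord n. *)
definition coord :: "nat \<Rightarrow> 'n::{finite,linorder}" where
  "coord i = sorted_list_of_set (UNIV :: 'n set) ! (i - 1)"

definition morin_form :: "nat \<Rightarrow> real^'n::{finite,linorder} \<Rightarrow> real^'n::{finite,linorder}" where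
  "morin_form k x = (\<chi> i. if i = coord 1
     then (\<Sum>j=2..k. (x $ coord 1) ^ (j - 1) * x $ coord j) + (x $ coord 1) ^ (k + 1)
     else x $ i)"

definition morin :: "nat \<Rightarrow> (real^'n::{finite,linorder} \<Rightarrow> real^'n::{finite,linorder}) \<Rightarrow> bool" where
  "morin k f \<longleftrightarrow> 1 \<le> k \<and> k \<le> CARD('n) \<and> A_equivalent f (morin_form k)"

end

theory Submission
  imports Defs
begin

text \<open>Path components of the space of jets of diffeomorphism germs are detected by the sign of
  the Jacobian determinant: \<open>x \<mapsto> f (t x) / t\<close> deforms a germ to its linear part, and the group
  \<open>GL\<close> has two components. Hence the group of sign pairs (source, target) acts transitively on the
  isotopy classes in an orbit, and one has to compute the stabiliser of the class of the normal
  form \<open>m\<close>, that is, the signs of pairs \<open>(S, R)\<close> for which \<open>m \<circ> S\<close> and \<open>R \<circ> m\<close> have the same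
  \<open>(k+1)\<close>-jet. Let \<open>a\<close> be the factor by which \<open>S\<close> scales the kernel
  direction. Comparing orders in \<open>t\<close> along the curve \<open>(t, 0, ..., 0)\<close>, where \<open>m\<close> takes the value
  \<open>(t\<^sup>k\<^sup>+\<^sup>1, 0, ..., 0)\<close>, shows that \<open>R\<close> scales the cokernel by \<open>a\<^sup>k\<^sup>+\<^sup>1\<close>, whence
  \<open>det R = a\<^sup>k det S\<close>; for \<open>k = n\<close> the first derivatives along this curve show in addition that the
  Jacobian of \<open>R\<close> is triangular with diagonal entries \<open>a\<^sup>k\<^sup>+\<^sup>1 / a\<^sup>l\<^sup>-\<^sup>1\<close>, so that the sign of
  \<open>a\<close> determines both orientations. The value \<open>a = -1\<close> is attained by a diagonal symmetry of \<open>m\<close>, and for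
  \<open>k < n\<close> a coordinate not involved in the first component of \<open>m\<close> can be reversed in source and target.\<close>

section \<open>Smooth functions and jets\<close>

text \<open>Isotopy compares jets only, so a symmetry is an identity up to an error O(|x|^(k+2)),
  and its first derivatives agree up to O(|x|^(k+1)). This precision suffices because values are
  divided by t^(k+1) at most, and derivatives by t^(l-1) with l - 1 < k, before a limit is taken.
  The analytic input is thus one Taylor estimate, together with the fact that equality of jets is a
  congruence for sums, products and composition. The counts come from the order of the stabiliser in
  the Klein four-group of sign pairs. For k = n, multiplying the diagonal entries gives det R =
  a^(k(k+1) - k(k-1)/2). Since k(k+1) is even, for a < 0 the target sign is (-1)^(k(k-1)/2), and the
  source sign is this times (-1)^k. Both are positive exactly if 4 divides k; then the stabiliser is
  trivial and there are four classes, otherwise it has order two. For k < n the pair (-,-) is always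
  present and (+,-) occurs exactly for odd k, so the stabiliser has order two or four.\<close>

lemma iter_deriv_append: "iter_deriv f (vs @ ws) = iter_deriv (iter_deriv f ws) vs"
  by (induction vs) auto

lemma has_derivative_cong_eventually:
  assumes "\<forall>\<^sub>F y in nhds x. f y = g y" and "(f has_derivative f') (at x)"
  shows "(g has_derivative f') (at x)"
proof -
  obtain X where X: "open X" "x \<in> X" "\<And>y. y \<in> X \<Longrightarrow> f y = g y"
    using assms(1) by (auto simp: eventually_nhds)
  show ?thesis
    by (rule has_derivative_transform_within_open[OF assms(2) X])
qed

lemma frechet_derivative_cong_eventually:
  assumes "\<forall>\<^sub>F y in nhds x. f y = g y"
  shows "frechet_derivative f (at x) = frechet_derivative g (at x)"
proof -
  have "\<forall>\<^sub>F y in nhds x. g y = f y"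
    using assms by (rule eventually_mono) simp
  then have "(f has_derivative f') (at x) \<longleftrightarrow> (g has_derivative f') (at x)" for f'
    using assms has_derivative_cong_eventually by blast
  then show ?thesis by (simp add: frechet_derivative_def)
qed

lemma iter_deriv_cong_eventually:
  assumes "\<forall>\<^sub>F y in nhds x. f y = g y"
  shows "\<forall>\<^sub>F y in nhds x. iter_deriv f vs y = iter_deriv g vs y"
proof (induction vs)
  case Nil
  then show ?case using assms by simp
next
  case (Cons v vs)
  have "\<forall>\<^sub>F y in nhds x. \<forall>\<^sub>F z in nhds y. iter_deriv f vs z = iter_deriv g vs z"
    using Cons eventually_eventually by blast
  then show ?case
    by (rule eventually_mono) (auto dest: frechet_derivative_cong_eventually)
qed

text \<open>The finite-order version of \<^const>\<open>smooth_on\<close> is what makes induction possible.\<close>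

definition diff_times_on ::
  "nat \<Rightarrow> 'a::real_normed_vector set \<Rightarrow> ('a \<Rightarrow> 'b::real_normed_vector) \<Rightarrow> bool" where
  "diff_times_on n S f \<longleftrightarrow> (\<forall>vs. length vs \<le> n \<longrightarrow> (\<forall>x\<in>S. iter_deriv f vs differentiable (at x)))"

abbreviation dderiv ::
  "('a::real_normed_vector \<Rightarrow> 'b::real_normed_vector) \<Rightarrow> 'a \<Rightarrow> 'a \<Rightarrow> 'b" where
  "dderiv f v \<equiv> \<lambda>x. frechet_derivative f (at x) v"

lemma smooth_on_iff_diff_times_on: "smooth_on S f \<longleftrightarrow> (\<forall>n. diff_times_on n S f)"
  by (auto simp: smooth_on_def diff_times_on_def)

lemma diff_times_on_0: "diff_times_on 0 S f \<longleftrightarrow> (\<forall>x\<in>S. f differentiable (at x))"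
  by (auto simp: diff_times_on_def)

text \<open>\<open>iter_deriv\<close> peels off the outermost derivative, but an induction over f
  has to replace f by a first derivative. Splitting off the innermost direction, the last list
  element, provides that recursion.\<close>

lemma diff_times_on_Suc:
  "diff_times_on (Suc n) S f \<longleftrightarrow>
    (\<forall>x\<in>S. f differentiable (at x)) \<and> (\<forall>v. diff_times_on n S (dderiv f v))"
  (is "?L \<longleftrightarrow> ?R")
proof
  assume L: ?L
  have "iter_deriv (dderiv f v) vs differentiable (at x)" if "length vs \<le> n" "x \<in> S" for v vs x
    using L that unfolding diff_times_on_def
    by (drule_tac x="vs @ [v]" in spec) (simp add: iter_deriv_append)
  moreover have "f differentiable (at x)" if "x \<in> S" for x
    using L that unfolding diff_times_on_def by (drule_tac x="[]" in spec) simp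
  ultimately show ?R by (auto simp: diff_times_on_def)
next
  assume R: ?R
  have "iter_deriv f vs differentiable (at x)" if "length vs \<le> Suc n" "x \<in> S" for vs x
    using that R by (cases vs rule: rev_cases) (auto simp: diff_times_on_def iter_deriv_append)
  then show ?L by (auto simp: diff_times_on_def)
qed

lemma diff_times_on_imp_differentiable:
  "diff_times_on n S f \<Longrightarrow> x \<in> S \<Longrightarrow> f differentiable (at x)"
  by (auto simp: diff_times_on_def dest: spec[of _ "[]"])

lemma diff_times_on_mono: "diff_times_on n S f \<Longrightarrow> m \<le> n \<Longrightarrow> T \<subseteq> S \<Longrightarrow> diff_times_on m T f"
  by (auto simp: diff_times_on_def)

lemma diff_times_on_SucD: "diff_times_on (Suc n) S f \<Longrightarrow> diff_times_on n S f"
  by (rule diff_times_on_mono) auto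

lemma differentiable_cong_eventually:
  assumes "\<forall>\<^sub>F y in nhds x. f y = g y" and "f differentiable (at x)"
  shows "g differentiable (at x)"
  using assms has_derivative_cong_eventually unfolding differentiable_def by blast

lemma diff_times_on_SucD2: "diff_times_on (Suc n) S f \<Longrightarrow> diff_times_on n S (dderiv f v)"
  by (simp add: diff_times_on_Suc)

lemma diff_times_on_cong:
  assumes "open U" "\<And>x. x \<in> U \<Longrightarrow> f x = g x" "diff_times_on n U f"
  shows "diff_times_on n U g"
proof -
  have "iter_deriv g vs differentiable (at x)" if "length vs \<le> n" "x \<in> U" for vs x
  proof (rule differentiable_cong_eventually)
    show "\<forall>\<^sub>F y in nhds x. iter_deriv f vs y = iter_deriv g vs y"
      by (rule iter_deriv_cong_eventually) (use assms that eventually_nhds in blast)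
    show "iter_deriv f vs differentiable (at x)"
      using assms that by (auto simp: diff_times_on_def)
  qed
  then show ?thesis by (auto simp: diff_times_on_def)
qed

text \<open>An explicit derivative may replace \<open>frechet_derivative\<close> because U is open:
  agreement on U is agreement near each of its points, and that passes to all iterated
  derivatives.\<close>

lemma diff_times_on_SucI:
  assumes "open U" "\<And>x. x \<in> U \<Longrightarrow> (f has_derivative f' x) (at x)"
    and "\<And>v. diff_times_on n U (\<lambda>x. f' x v)"
  shows "diff_times_on (Suc n) U f"
proof -
  have "diff_times_on n U (dderiv f v)" for v
    by (rule diff_times_on_cong[OF assms(1) _ assms(3)[of v]])
       (metis assms(2) frechet_derivative_at)
  then show ?thesis using assms(2) by (auto simp: diff_times_on_Suc differentiable_def)
qed

lemma diff_times_onI: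
  assumes "open U" "\<And>x. x \<in> U \<Longrightarrow> (f has_derivative f' x) (at x)"
    and "\<And>m v. n = Suc m \<Longrightarrow> diff_times_on m U (\<lambda>x. f' x v)"
  shows "diff_times_on n U f"
proof (cases n)
  case 0
  then show ?thesis using assms(2) by (auto simp: diff_times_on_0 differentiable_def)
next
  case (Suc m)
  then show ?thesis using diff_times_on_SucI assms by blast
qed

lemma diff_times_on_has_derivative:
  "diff_times_on n S f \<Longrightarrow> x \<in> S \<Longrightarrow> (f has_derivative frechet_derivative f (at x)) (at x)"
  using diff_times_on_imp_differentiable frechet_derivative_works by blast

lemma diff_times_on_const: "open U \<Longrightarrow> diff_times_on n U (\<lambda>x. c)"
proof (induction n arbitrary: c)
  case (Suc n) then show ?case by (intro diff_times_on_SucI[where f'="\<lambda>_ _. 0"]) auto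
qed (auto simp: diff_times_on_0)

lemma diff_times_on_bounded_linear:
  assumes "open U" "bounded_linear f"
  shows "diff_times_on n U f"
  by (rule diff_times_onI[where f'="\<lambda>_. f"])
     (use assms bounded_linear_imp_has_derivative diff_times_on_const in auto)

lemma diff_times_on_add:
  assumes "open U" "diff_times_on n U f" "diff_times_on n U g"
  shows "diff_times_on n U (\<lambda>x. f x + g x)"
  using assms
proof (induction n arbitrary: f g)
  case 0 then show ?case by (auto simp: diff_times_on_0)
next
  case (Suc n)
  show ?case
    by (rule diff_times_on_SucI[OF Suc.prems(1) has_derivative_add[OF
            diff_times_on_has_derivative[OF Suc.prems(2)] diff_times_on_has_derivative[OF Suc.prems(3)]]])
       (use Suc in \<open>auto simp: diff_times_on_Suc\<close>)
qed

text \<open>One Leibniz rule for scalar multiplication and inner product, both of which occur in the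
  chain rule below.\<close>

lemma diff_times_on_bounded_bilinear:
  assumes "bounded_bilinear pr" "open U" "diff_times_on n U f" "diff_times_on n U g"
  shows "diff_times_on n U (\<lambda>x. pr (f x) (g x))"
  using assms
proof (induction n arbitrary: f g)
  case 0 
  then show ?case
    unfolding diff_times_on_0 differentiable_def using bounded_bilinear.FDERIV by fast
next
  case (Suc n)
  interpret bounded_bilinear pr by fact
  have der: "diff_times_on n U (\<lambda>x. pr (f x) (dderiv g v x) + pr (dderiv f v x) (g x))" for v
    by (intro diff_times_on_add Suc.IH bounded_bilinear_axioms Suc.prems(2))
       (use Suc.prems(3,4) diff_times_on_SucD in \<open>auto simp: diff_times_on_Suc\<close>)
  show ?case
    by (rule diff_times_on_SucI[OF Suc.prems(2) FDERIV[OF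
            diff_times_on_has_derivative[OF Suc.prems(3)] diff_times_on_has_derivative[OF Suc.prems(4)]]])
       (simp_all add: der)
qed

lemma diff_times_on_sum:
  assumes "open U" "\<And>i. i \<in> I \<Longrightarrow> diff_times_on n U (f i)"
  shows "diff_times_on n U (\<lambda>x. \<Sum>i\<in>I. f i x)"
  using assms(2)
  by (induction I rule: infinite_finite_induct)
     (auto intro: diff_times_on_const diff_times_on_add assms(1))

lemma frechet_derivative_basis_expansion:
  fixes f :: "'b::euclidean_space \<Rightarrow> 'c::real_normed_vector"
  assumes "f differentiable (at y)"
  shows "frechet_derivative f (at y) w = (\<Sum>i\<in>Basis. (w \<bullet> i) *\<^sub>R frechet_derivative f (at y) i)"
proof -
  have l: "linear (frechet_derivative f (at y))"
    by (rule linear_frechet_derivative[OF assms])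
  have "frechet_derivative f (at y) w = frechet_derivative f (at y) (\<Sum>i\<in>Basis. (w \<bullet> i) *\<^sub>R i)"
    by (simp add: euclidean_representation)
  also have "\<dots> = (\<Sum>i\<in>Basis. (w \<bullet> i) *\<^sub>R frechet_derivative f (at y) i)"
    by (simp add: linear_sum[OF l] linear_cmul[OF l])
  finally show ?thesis .
qed

text \<open>In the chain rule the direction in which f is differentiated varies with x. Expanding it
  in the fixed basis leaves products of scalar functions with compositions of a fixed
  \<open>dderiv f i\<close> and the same g, a form that an induction on the order can reuse.\<close>

lemma has_derivative_compose_basis:
  fixes f :: "'b::euclidean_space \<Rightarrow> 'c::real_normed_vector"
  assumes "g differentiable (at x)" "f differentiable (at (g x))"
  shows "((\<lambda>x. f (g x)) has_derivative
    (\<lambda>v. \<Sum>i\<in>Basis. (dderiv g v x \<bullet> i) *\<^sub>R dderiv f i (g x))) (at x)"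
proof -
  have "((f \<circ> g) has_derivative frechet_derivative f (at (g x)) \<circ> frechet_derivative g (at x)) (at x)"
    by (rule diff_chain_at) (use assms in \<open>simp_all flip: frechet_derivative_works\<close>)
  moreover have "frechet_derivative f (at (g x)) \<circ> frechet_derivative g (at x)
      = (\<lambda>v. \<Sum>i\<in>Basis. (dderiv g v x \<bullet> i) *\<^sub>R dderiv f i (g x))"
    unfolding comp_def by (rule ext) (rule frechet_derivative_basis_expansion[OF assms(2)])
  ultimately show ?thesis by (simp add: comp_def)
qed

lemma diff_times_on_compose:
  fixes f :: "'b::euclidean_space \<Rightarrow> 'c::real_normed_vector"
  assumes "open U" "diff_times_on n V f" "diff_times_on n U g" "g ` U \<subseteq> V"
  shows "diff_times_on n U (\<lambda>x. f (g x))"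
  using assms(2,3)
proof (induction n arbitrary: f)
  case 0
  show ?case unfolding diff_times_on_0
  proof
    fix x assume "x \<in> U"
    then have "g differentiable (at x)" "f differentiable (at (g x))"
      using 0 assms(4) by (auto simp: diff_times_on_0)
    from has_derivative_compose_basis[OF this] show "(\<lambda>x. f (g x)) differentiable (at x)"
      by (rule differentiableI)
  qed
next
  case (Suc n)
  show ?case
  proof (rule diff_times_on_SucI[OF assms(1) has_derivative_compose_basis])
    show "diff_times_on n U (\<lambda>x. \<Sum>i\<in>Basis. (dderiv g v x \<bullet> i) *\<^sub>R dderiv f i (g x))" for v
      by (intro diff_times_on_sum assms(1) Suc.IH
          diff_times_on_bounded_bilinear[OF bounded_bilinear_scaleR]
          diff_times_on_bounded_bilinear[OF bounded_bilinear_inner] diff_times_on_const)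
         (use Suc.prems diff_times_on_SucD in \<open>auto simp: diff_times_on_Suc\<close>)
  qed (use Suc.prems assms(4) in \<open>auto dest: diff_times_on_imp_differentiable\<close>)
qed

text \<open>Smoothness at a point without the condition f 0 = 0 of \<open>smooth_germs\<close>,
  which derivatives of germs violate in general.\<close>

definition smooth_near ::
  "'a::real_normed_vector \<Rightarrow> ('a \<Rightarrow> 'b::real_normed_vector) \<Rightarrow> bool" where
  "smooth_near p f \<longleftrightarrow> (\<exists>U. open U \<and> p \<in> U \<and> smooth_on U f)"

lemma smooth_germs_iff: "f \<in> smooth_germs \<longleftrightarrow> f 0 = 0 \<and> smooth_near 0 f"
  by (auto simp: smooth_germs_def smooth_near_def)

lemma smooth_nearE:
  assumes "smooth_near p f"
  obtains U where "open U" "p \<in> U" "\<And>n. diff_times_on n U f"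
  using assms by (auto simp: smooth_near_def smooth_on_iff_diff_times_on)

lemma smooth_nearE2:
  assumes "smooth_near p f" "smooth_near p g"
  obtains U where "open U" "p \<in> U" "\<And>n. diff_times_on n U f" "\<And>n. diff_times_on n U g"
proof -
  obtain U V where "open U" "p \<in> U" "\<And>n. diff_times_on n U f"
    "open V" "p \<in> V" "\<And>n. diff_times_on n V g"
    using assms by (metis smooth_nearE)
  then show ?thesis
    by (intro that[of "U \<inter> V"]) (auto intro: diff_times_on_mono)
qed

lemma smooth_nearI:
  "open U \<Longrightarrow> p \<in> U \<Longrightarrow> (\<And>n. diff_times_on n U f) \<Longrightarrow> smooth_near p f"
  by (auto simp: smooth_near_def smooth_on_iff_diff_times_on)

lemma smooth_near_const: "smooth_near p (\<lambda>x. c)"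
  by (rule smooth_nearI[of UNIV]) (auto intro: diff_times_on_const)

lemma smooth_near_bounded_linear: "bounded_linear f \<Longrightarrow> smooth_near p f"
  by (rule smooth_nearI[of UNIV]) (auto intro: diff_times_on_bounded_linear)

lemma smooth_near_add: "smooth_near p f \<Longrightarrow> smooth_near p g \<Longrightarrow> smooth_near p (\<lambda>x. f x + g x)"
  by (erule smooth_nearE2, assumption) (auto intro: smooth_nearI diff_times_on_add)

lemma smooth_near_bounded_bilinear:
  "bounded_bilinear pr \<Longrightarrow> smooth_near p f \<Longrightarrow> smooth_near p g \<Longrightarrow>
    smooth_near p (\<lambda>x. pr (f x) (g x))"
  by (erule smooth_nearE2, assumption) (auto intro: smooth_nearI diff_times_on_bounded_bilinear)

lemma smooth_near_sum:
  "(\<And>i. i \<in> I \<Longrightarrow> smooth_near p (f i)) \<Longrightarrow> smooth_near p (\<lambda>x. \<Sum>i\<in>I. f i x)"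
  by (induction I rule: infinite_finite_induct) (auto intro: smooth_near_const smooth_near_add)

lemma smooth_near_dderiv: "smooth_near p f \<Longrightarrow> smooth_near p (dderiv f v)"
  by (erule smooth_nearE, rule smooth_nearI) (auto simp flip: diff_times_on_Suc intro: diff_times_on_SucD2)

lemma smooth_near_differentiable: "smooth_near p f \<Longrightarrow> f differentiable (at p)"
  by (erule smooth_nearE) (blast intro: diff_times_on_imp_differentiable)

lemma smooth_near_eventually_differentiable:
  "smooth_near p f \<Longrightarrow> \<forall>\<^sub>F x in nhds p. f differentiable (at x)"
  by (erule smooth_nearE) (meson diff_times_on_imp_differentiable eventually_nhds)

lemma smooth_near_isCont: "smooth_near p f \<Longrightarrow> isCont f p"
  by (simp add: differentiable_imp_continuous_within smooth_near_differentiable)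

lemma smooth_near_compose:
  fixes f :: "'b::euclidean_space \<Rightarrow> 'c::real_normed_vector"
  assumes "smooth_near (g p) f" "smooth_near p g"
  shows "smooth_near p (\<lambda>x. f (g x))"
proof -
  obtain V where V: "open V" "g p \<in> V" "\<And>n. diff_times_on n V f"
    using smooth_nearE[OF assms(1)] by metis
  obtain U where U: "open U" "p \<in> U" "\<And>n. diff_times_on n U g"
    using smooth_nearE[OF assms(2)] by metis
  have cont: "continuous_on U g"
    by (meson U(3) continuous_at_imp_continuous_on diff_times_on_imp_differentiable
        differentiable_imp_continuous_within)
  then have op: "open (U \<inter> g -` V)"
    using U(1) V(1) continuous_on_open_vimage by (metis Int_commute)
  have "diff_times_on n (U \<inter> g -` V) (\<lambda>x. f (g x))" for n
    by (rule diff_times_on_compose[OF op V(3)]) (use U(3) in \<open>auto intro: diff_times_on_mono\<close>)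
  then show ?thesis using op U(2) V(2) by (intro smooth_nearI[OF op]) auto
qed

section \<open>Equality of jets as a congruence\<close>

definition jet_eq ::
  "nat \<Rightarrow> ('a::euclidean_space \<Rightarrow> 'b::real_normed_vector) \<Rightarrow> ('a \<Rightarrow> 'b) \<Rightarrow> bool" where
  "jet_eq r f g \<longleftrightarrow> jet r f = jet r g"

lemma jet_eq_iff:
  "jet_eq r f g \<longleftrightarrow>
    (\<forall>vs. length vs \<le> r \<and> set vs \<subseteq> Basis \<longrightarrow> iter_deriv f vs 0 = iter_deriv g vs 0)"
  unfolding jet_eq_def jet_def fun_eq_iff by auto

lemma jet_eq_refl: "jet_eq r f f" by (simp add: jet_eq_def)
lemma jet_eq_sym: "jet_eq r f g \<Longrightarrow> jet_eq r g f" by (simp add: jet_eq_def)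
lemma jet_eq_trans: "jet_eq r f g \<Longrightarrow> jet_eq r g h \<Longrightarrow> jet_eq r f h" by (simp add: jet_eq_def)

lemma jet_eq_mono: "jet_eq r f g \<Longrightarrow> s \<le> r \<Longrightarrow> jet_eq s f g"
  by (auto simp: jet_eq_iff)

lemma jet_eq_0: "jet_eq 0 f g \<longleftrightarrow> f 0 = g 0"
  by (auto simp: jet_eq_iff)

text \<open>Again the innermost derivative is split off; this recursion drives the inductions on r
  for sums, products and compositions.\<close>

lemma jet_eq_Suc:
  "jet_eq (Suc r) f g \<longleftrightarrow> f 0 = g 0 \<and> (\<forall>i\<in>Basis. jet_eq r (dderiv f i) (dderiv g i))"
  (is "?L \<longleftrightarrow> ?R")
proof
  assume L: ?L
  have "iter_deriv (dderiv f v) vs 0 = iter_deriv (dderiv g v) vs 0"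
    if "length vs \<le> r" "set vs \<subseteq> Basis" "v \<in> Basis" for v vs
    using L that unfolding jet_eq_iff
    by (drule_tac x="vs @ [v]" in spec) (simp add: iter_deriv_append)
  moreover have "f 0 = g 0"
    using L unfolding jet_eq_iff by (drule_tac x="[]" in spec) simp
  ultimately show ?R by (auto simp: jet_eq_iff)
next
  assume R: ?R
  have "iter_deriv f vs 0 = iter_deriv g vs 0" if "length vs \<le> Suc r" "set vs \<subseteq> Basis" for vs
    using that R by (cases vs rule: rev_cases) (auto simp: jet_eq_iff iter_deriv_append)
  then show ?L by (auto simp: jet_eq_iff)
qed

lemma jet_eq_value: "jet_eq r f g \<Longrightarrow> f 0 = g 0"
  using jet_eq_mono[of r f g 0] by (simp add: jet_eq_0)

lemma jet_eq_SucD: "jet_eq (Suc r) f g \<Longrightarrow> jet_eq r f g"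
  by (rule jet_eq_mono) auto

lemma jet_eq_SucD2: "jet_eq (Suc r) f g \<Longrightarrow> i \<in> Basis \<Longrightarrow> jet_eq r (dderiv f i) (dderiv g i)"
  by (simp add: jet_eq_Suc)

lemma jet_eq_eventually:
  assumes "\<forall>\<^sub>F x in nhds 0. f x = g x"
  shows "jet_eq r f g"
  unfolding jet_eq_iff
  by (blast intro: eventually_nhds_x_imp_x[OF iter_deriv_cong_eventually[OF assms]])

lemma jet_eq_cong:
  assumes "\<forall>\<^sub>F x in nhds 0. f x = f' x" "\<forall>\<^sub>F x in nhds 0. g x = g' x"
  shows "jet_eq r f g \<longleftrightarrow> jet_eq r f' g'"
  using jet_eq_eventually[OF assms(1), of r] jet_eq_eventually[OF assms(2), of r]
  by (simp add: jet_eq_def)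

lemma jet_eq_SucI:
  fixes f g :: "'a::euclidean_space \<Rightarrow> 'b::real_normed_vector"
  assumes "f 0 = g 0"
    and "\<forall>\<^sub>F x in nhds 0. (f has_derivative f' x) (at x)"
    and "\<forall>\<^sub>F x in nhds 0. (g has_derivative g' x) (at x)"
    and "\<And>v. v \<in> Basis \<Longrightarrow> jet_eq r (\<lambda>x. f' x v) (\<lambda>x. g' x v)"
  shows "jet_eq (Suc r) f g"
  unfolding jet_eq_Suc
proof (intro conjI ballI assms(1))
  fix v :: 'a assume v: "v \<in> Basis"
  have "\<forall>\<^sub>F x in nhds 0. dderiv f v x = f' x v"
    using assms(2) by (rule eventually_mono) (metis frechet_derivative_at)
  moreover have "\<forall>\<^sub>F x in nhds 0. dderiv g v x = g' x v"
    using assms(3) by (rule eventually_mono) (metis frechet_derivative_at)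
  ultimately show "jet_eq r (dderiv f v) (dderiv g v)"
    using assms(4)[OF v] by (simp add: jet_eq_cong)
qed

lemma smooth_near_eventually_has_derivative:
  assumes "smooth_near p f"
  shows "\<forall>\<^sub>F x in nhds p. (f has_derivative (\<lambda>v. dderiv f v x)) (at x)"
  using smooth_near_eventually_differentiable[OF assms]
  by (rule eventually_mono) (simp flip: frechet_derivative_works)

lemma jet_eq_add:
  assumes "smooth_near 0 f" "smooth_near 0 g" "smooth_near 0 f'" "smooth_near 0 g'"
    "jet_eq r f f'" "jet_eq r g g'"
  shows "jet_eq r (\<lambda>x. f x + g x) (\<lambda>x. f' x + g' x)"
  using assms
proof (induction r arbitrary: f g f' g')
  case 0 then show ?case by (simp add: jet_eq_0)
next
  case (Suc r)
  show ?case
  proof (rule jet_eq_SucI)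
    show "\<forall>\<^sub>F x in nhds 0. ((\<lambda>x. f x + g x) has_derivative (\<lambda>v. dderiv f v x + dderiv g v x)) (at x)"
      by (rule eventually_elim2[OF smooth_near_eventually_has_derivative[OF Suc.prems(1)]
            smooth_near_eventually_has_derivative[OF Suc.prems(2)]]) (rule has_derivative_add)
    show "\<forall>\<^sub>F x in nhds 0. ((\<lambda>x. f' x + g' x) has_derivative (\<lambda>v. dderiv f' v x + dderiv g' v x)) (at x)"
      by (rule eventually_elim2[OF smooth_near_eventually_has_derivative[OF Suc.prems(3)]
            smooth_near_eventually_has_derivative[OF Suc.prems(4)]]) (rule has_derivative_add)
  qed (use Suc.prems in \<open>auto intro!: Suc.IH smooth_near_dderiv simp: jet_eq_Suc\<close>)
qed

lemma jet_eq_sum: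
  assumes "\<And>i. i \<in> I \<Longrightarrow> smooth_near 0 (f i)" "\<And>i. i \<in> I \<Longrightarrow> smooth_near 0 (g i)"
    "\<And>i. i \<in> I \<Longrightarrow> jet_eq r (f i) (g i)"
  shows "jet_eq r (\<lambda>x. \<Sum>i\<in>I. f i x) (\<lambda>x. \<Sum>i\<in>I. g i x)"
  using assms
  by (induction I rule: infinite_finite_induct)
     (auto intro!: jet_eq_refl jet_eq_add smooth_near_sum)

lemma jet_eq_bounded_bilinear:
  assumes "bounded_bilinear pr"
    "smooth_near 0 f" "smooth_near 0 g" "smooth_near 0 f'" "smooth_near 0 g'"
    "jet_eq r f f'" "jet_eq r g g'"
  shows "jet_eq r (\<lambda>x. pr (f x) (g x)) (\<lambda>x. pr (f' x) (g' x))"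
  using assms
proof (induction r arbitrary: f g f' g')
  case 0 then show ?case by (simp add: jet_eq_0)
next
  case (Suc r)
  interpret bounded_bilinear pr by fact
  have der: "\<forall>\<^sub>F x in nhds 0. ((\<lambda>x. pr (f x) (g x)) has_derivative
      (\<lambda>v. pr (f x) (dderiv g v x) + pr (dderiv f v x) (g x))) (at x)"
    if "smooth_near 0 f" "smooth_near 0 g" for f g
    by (rule eventually_elim2[OF smooth_near_eventually_has_derivative[OF that(1)]
            smooth_near_eventually_has_derivative[OF that(2)]]) (rule FDERIV)
  show ?case
  proof (rule jet_eq_SucI)
    show "\<forall>\<^sub>F x in nhds 0. ((\<lambda>x. pr (f x) (g x)) has_derivative
      (\<lambda>v. pr (f x) (dderiv g v x) + pr (dderiv f v x) (g x))) (at x)"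
      using der Suc.prems by blast
    show "\<forall>\<^sub>F x in nhds 0. ((\<lambda>x. pr (f' x) (g' x)) has_derivative
      (\<lambda>v. pr (f' x) (dderiv g' v x) + pr (dderiv f' v x) (g' x))) (at x)"
      using der Suc.prems by blast
    show "jet_eq r (\<lambda>x. pr (f x) (dderiv g v x) + pr (dderiv f v x) (g x))
        (\<lambda>x. pr (f' x) (dderiv g' v x) + pr (dderiv f' v x) (g' x))" if "v \<in> Basis" for v
      by (intro jet_eq_add Suc.IH smooth_near_dderiv smooth_near_bounded_bilinear[OF assms(1)]
          Suc.prems jet_eq_SucD2[OF Suc.prems(6) that] jet_eq_SucD2[OF Suc.prems(7) that]
          jet_eq_SucD[OF Suc.prems(6)] jet_eq_SucD[OF Suc.prems(7)])
  qed (use Suc.prems in \<open>auto dest!: jet_eq_value\<close>)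
qed

lemma eventually_nhds_compose:
  assumes "\<forall>\<^sub>F y in nhds (g p). P y" "isCont g p"
  shows "\<forall>\<^sub>F x in nhds p. P (g x)"
proof -
  have "filterlim g (nhds (g p)) (nhds p)"
    using assms(2) by (simp add: isCont_def tendsto_at_iff_tendsto_nhds)
  then show ?thesis using assms(1) eventually_compose_filterlim by blast
qed

text \<open>Induction on r through the basis form of the chain rule, with f and f' generalised while
  g and g' stay fixed.\<close>

lemma jet_eq_compose:
  fixes f f' :: "'b::euclidean_space \<Rightarrow> 'c::real_normed_vector"
    and g g' :: "'a::euclidean_space \<Rightarrow> 'b"
  assumes "g 0 = 0" "g' 0 = 0"
    "smooth_near 0 f" "smooth_near 0 g" "smooth_near 0 f'" "smooth_near 0 g'"
    "jet_eq r f f'" "jet_eq r g g'"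
  shows "jet_eq r (\<lambda>x. f (g x)) (\<lambda>x. f' (g' x))"
  using assms(3,5,7,8)
proof (induction r arbitrary: f f')
  case 0 then show ?case using assms(1,2) by (simp add: jet_eq_0)
next
  case (Suc r)
  have der: "\<forall>\<^sub>F x in nhds 0. ((\<lambda>x. f (g x)) has_derivative
      (\<lambda>v. \<Sum>i\<in>Basis. (dderiv g v x \<bullet> i) *\<^sub>R dderiv f i (g x))) (at x)"
    if "smooth_near 0 f" "smooth_near 0 g" "g 0 = 0"
    for f :: "'b \<Rightarrow> 'c" and g :: "'a \<Rightarrow> 'b"
  proof -
    have "\<forall>\<^sub>F x in nhds 0. f differentiable (at (g x))"
      by (rule eventually_nhds_compose)
         (simp_all add: that smooth_near_isCont smooth_near_eventually_differentiable)
    with smooth_near_eventually_differentiable[OF that(2)] show ?thesis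
      by (rule eventually_elim2) (rule has_derivative_compose_basis)
  qed
  show ?case
  proof (rule jet_eq_SucI)
    show "f (g 0) = f' (g' 0)"
      using Suc.prems assms(1,2) by (simp add: jet_eq_Suc)
    show "\<forall>\<^sub>F x in nhds 0. ((\<lambda>x. f (g x)) has_derivative
      (\<lambda>v. \<Sum>i\<in>Basis. (dderiv g v x \<bullet> i) *\<^sub>R dderiv f i (g x))) (at x)"
      using der Suc.prems(1) assms(1,4) by blast
    show "\<forall>\<^sub>F x in nhds 0. ((\<lambda>x. f' (g' x)) has_derivative
      (\<lambda>v. \<Sum>i\<in>Basis. (dderiv g' v x \<bullet> i) *\<^sub>R dderiv f' i (g' x))) (at x)"
      using der Suc.prems(2) assms(2,6) by blast
    show "jet_eq r (\<lambda>x. \<Sum>i\<in>Basis. (dderiv g v x \<bullet> i) *\<^sub>R dderiv f i (g x))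
            (\<lambda>x. \<Sum>i\<in>Basis. (dderiv g' v x \<bullet> i) *\<^sub>R dderiv f' i (g' x))"
      if "v \<in> Basis" for v
    proof (rule jet_eq_sum)
      fix i :: 'b assume i: "i \<in> Basis"
      note bil = bounded_bilinear_scaleR bounded_bilinear_inner
      have sm: "smooth_near 0 (\<lambda>x. dderiv f i (g x))" "smooth_near 0 (\<lambda>x. dderiv f' i (g' x))"
        using smooth_near_compose[of g 0 "dderiv f i"] smooth_near_compose[of g' 0 "dderiv f' i"]
        by (simp_all add: assms Suc.prems smooth_near_dderiv)
      have inn: "smooth_near 0 (\<lambda>x. dderiv g v x \<bullet> i)" "smooth_near 0 (\<lambda>x. dderiv g' v x \<bullet> i)"
        by (rule smooth_near_bounded_bilinear[OF bil(2)];
            simp add: smooth_near_const smooth_near_dderiv assms)+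
      show "smooth_near 0 (\<lambda>x. (dderiv g v x \<bullet> i) *\<^sub>R dderiv f i (g x))"
        "smooth_near 0 (\<lambda>x. (dderiv g' v x \<bullet> i) *\<^sub>R dderiv f' i (g' x))"
        by (rule smooth_near_bounded_bilinear[OF bil(1) inn(1) sm(1)],
            rule smooth_near_bounded_bilinear[OF bil(1) inn(2) sm(2)])
      have "jet_eq r (\<lambda>x. dderiv f i (g x)) (\<lambda>x. dderiv f' i (g' x))"
        by (rule Suc.IH[OF smooth_near_dderiv smooth_near_dderiv])
          (use Suc.prems i in \<open>auto intro: jet_eq_SucD2 jet_eq_SucD\<close>)
      moreover have "jet_eq r (\<lambda>x. dderiv g v x \<bullet> i) (\<lambda>x. dderiv g' v x \<bullet> i)"
        by (rule jet_eq_bounded_bilinear[OF bil(2)])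
          (use Suc.prems that assms in \<open>auto intro!: smooth_near_dderiv smooth_near_const jet_eq_refl
              intro: jet_eq_SucD2\<close>)
      ultimately show "jet_eq r (\<lambda>x. (dderiv g v x \<bullet> i) *\<^sub>R dderiv f i (g x))
          (\<lambda>x. (dderiv g' v x \<bullet> i) *\<^sub>R dderiv f' i (g' x))"
        by (intro jet_eq_bounded_bilinear[OF bil(1)] inn sm)
    qed
  qed
qed

text \<open>A Taylor estimate without Taylor polynomials: the partial derivatives of h are flat to
  one order less, so induction bounds them, and the mean value inequality on a ball regains the lost
  power of |x|.\<close>

lemma flat_bound:
  fixes h :: "'a::euclidean_space \<Rightarrow> 'b::real_normed_vector"
  assumes "smooth_near 0 h"
    "\<And>vs. length vs < n \<Longrightarrow> set vs \<subseteq> Basis \<Longrightarrow> iter_deriv h vs 0 = 0"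
  shows "\<exists>C. \<forall>\<^sub>F x in nhds 0. norm (h x) \<le> C * norm x ^ n"
  using assms
proof (induction n arbitrary: h)
  case 0
  have "(h \<longlongrightarrow> h 0) (nhds 0)"
    using smooth_near_isCont[OF 0(1)] by (simp add: isCont_def tendsto_at_iff_tendsto_nhds)
  then have "\<forall>\<^sub>F x in nhds 0. dist (h x) (h 0) < 1"
    by (rule tendstoD) simp
  then have "\<forall>\<^sub>F x in nhds 0. norm (h x) \<le> (norm (h 0) + 1) * norm x ^ 0"
  proof (rule eventually_mono)
    fix x assume "dist (h x) (h 0) < 1"
    then show "norm (h x) \<le> (norm (h 0) + 1) * norm x ^ 0"
      using norm_triangle_sub[of "h x" "h 0"] by (simp add: dist_norm)
  qed
  then show ?case by blast
next
  case (Suc n)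
  have "\<exists>C. \<forall>\<^sub>F x in nhds 0. norm (dderiv h i x) \<le> C * norm x ^ n" if "i \<in> Basis" for i
  proof (rule Suc.IH)
    show "smooth_near 0 (dderiv h i)" by (rule smooth_near_dderiv[OF Suc.prems(1)])
    show "iter_deriv (dderiv h i) vs 0 = 0" if "length vs < n" "set vs \<subseteq> Basis" for vs
      using Suc.prems(2)[of "vs @ [i]"] that \<open>i \<in> Basis\<close> by (simp add: iter_deriv_append)
  qed
  then obtain C where C: "\<And>i. i \<in> Basis \<Longrightarrow> \<forall>\<^sub>F x in nhds 0. norm (dderiv h i x) \<le> C i * norm x ^ n"
    by metis
  have "\<forall>\<^sub>F x in nhds 0. \<forall>i\<in>Basis. norm (dderiv h i x) \<le> C i * norm x ^ n"
    using C by (simp add: eventually_ball_finite)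
  with smooth_near_eventually_differentiable[OF Suc.prems(1)]
  have "\<forall>\<^sub>F x in nhds 0. h differentiable (at x) \<and> (\<forall>i\<in>Basis. norm (dderiv h i x) \<le> C i * norm x ^ n)"
    by eventually_elim auto
  then obtain d where d: "d > 0" "\<And>x. norm x < d \<Longrightarrow> h differentiable (at x)"
    "\<And>x i. norm x < d \<Longrightarrow> i \<in> Basis \<Longrightarrow> norm (dderiv h i x) \<le> C i * norm x ^ n"
    by (auto simp: eventually_nhds_metric)
  \<comment> \<open>\<open>K\<close> bounds the operator norm of the derivative through its basis
    expansion; absolute values are taken because the induction gives no sign for
    \<open>C i\<close>.\<close>
  define K where "K = (\<Sum>i\<in>Basis. \<bar>C i\<bar>)"
  have "norm (h x) \<le> K * norm x ^ Suc n" if x: "norm x < d" for x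
  proof -
    \<comment> \<open>The ball of radius |x| is convex, contains 0 and x, and keeps |y|^n below
      |x|^n for all its points y.\<close>
    have "norm (h x - h 0) \<le> (K * norm x ^ n) * norm (x - 0)"
    proof (rule differentiable_bound)
      show "convex (cball 0 (norm x) :: 'a set)" by simp
      fix y :: 'a assume "y \<in> cball 0 (norm x)"
      then have y: "norm y \<le> norm x" "norm y < d" using x by auto
      show "(h has_derivative frechet_derivative h (at y)) (at y within cball 0 (norm x))"
        using d(2)[OF y(2)] has_derivative_at_withinI by (auto simp: frechet_derivative_works)
      show "onorm (frechet_derivative h (at y)) \<le> K * norm x ^ n"
      proof (rule onorm_le)
        fix w
        have "norm (frechet_derivative h (at y) w)
            = norm (\<Sum>i\<in>Basis. (w \<bullet> i) *\<^sub>R frechet_derivative h (at y) i)"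
          using frechet_derivative_basis_expansion[OF d(2)[OF y(2)], of w] by simp
        also have "\<dots> \<le> (\<Sum>i\<in>Basis. norm ((w \<bullet> i) *\<^sub>R frechet_derivative h (at y) i))"
          by (rule norm_sum)
        also have "\<dots> \<le> (\<Sum>i\<in>Basis. norm w * (\<bar>C i\<bar> * norm x ^ n))"
        proof (rule sum_mono)
          fix i :: 'a assume i: "i \<in> Basis"
          have "norm (frechet_derivative h (at y) i) \<le> C i * norm y ^ n"
            using d(3)[OF y(2) i] .
          also have "\<dots> \<le> \<bar>C i\<bar> * norm x ^ n"
            by (intro mult_mono power_mono) (use y in auto)
          finally show "norm ((w \<bullet> i) *\<^sub>R frechet_derivative h (at y) i) \<le> norm w * (\<bar>C i\<bar> * norm x ^ n)"
            by (simp add: mult_mono Basis_le_norm[OF i])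
        qed
        also have "\<dots> = K * norm x ^ n * norm w"
          by (simp add: K_def sum_distrib_left sum_distrib_right mult_ac)
        finally show "norm (frechet_derivative h (at y) w) \<le> K * norm x ^ n * norm w" .
      qed
    qed auto
    moreover have "h 0 = 0" using Suc.prems(2)[of "[]"] by simp
    ultimately show ?thesis by (simp add: mult_ac)
  qed
  then have "\<forall>\<^sub>F x in nhds 0. norm (h x) \<le> K * norm x ^ Suc n"
    using d(1) by (auto simp: eventually_nhds_metric)
  then show ?case by blast
qed

lemma jet_eq_bound:
  fixes f g :: "'a::euclidean_space \<Rightarrow> 'b::real_normed_vector"
  assumes "smooth_near 0 f" "smooth_near 0 g" "jet_eq r f g"
  shows "\<exists>C. \<forall>\<^sub>F x in nhds 0. norm (f x - g x) \<le> C * norm x ^ Suc r"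
proof (rule flat_bound)
  have neg: "smooth_near 0 (\<lambda>x. - g x)"
    by (rule smooth_near_bounded_bilinear[OF bounded_bilinear_scaleR smooth_near_const assms(2),
        of "-1", simplified])
  show "smooth_near 0 (\<lambda>x. f x - g x)"
    using smooth_near_add[OF assms(1) neg] by simp
  have "jet_eq r (\<lambda>x. f x + (- g x)) (\<lambda>x. g x + (- g x))"
    by (intro jet_eq_add assms neg jet_eq_refl)
  then have "jet_eq r (\<lambda>x. f x - g x) (\<lambda>x. 0)" by simp
  moreover have "iter_deriv (\<lambda>x. 0 :: 'b) vs = (\<lambda>x. 0)" for vs :: "'a list"
    by (induction vs) auto
  ultimately show "iter_deriv (\<lambda>x. f x - g x) vs 0 = 0" if "length vs < Suc r" "set vs \<subseteq> Basis" for vs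
    using that by (auto simp: jet_eq_iff)
qed

section \<open>Diffeomorphism germs and their Jacobians\<close>

lemma smooth_germsD: "f \<in> smooth_germs \<Longrightarrow> f 0 = 0" "f \<in> smooth_germs \<Longrightarrow> smooth_near 0 f"
  by (auto simp: smooth_germs_iff)

lemma diffeo_germsD:
  assumes "f \<in> diffeo_germs"
  shows "f \<in> smooth_germs" "f 0 = 0" "smooth_near 0 f"
  using assms by (auto simp: diffeo_germs_def dest: smooth_germsD)

lemma smooth_germs_compose:
  fixes f :: "'b::euclidean_space \<Rightarrow> 'c::real_normed_vector"
  assumes "f \<in> smooth_germs" "g \<in> smooth_germs"
  shows "(\<lambda>x. f (g x)) \<in> smooth_germs"
  using assms by (auto simp: smooth_germs_iff intro: smooth_near_compose)

lemma eventually_nhds_0_compose: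
  assumes "g \<in> smooth_germs" "\<forall>\<^sub>F y in nhds 0. P y"
  shows "\<forall>\<^sub>F x in nhds 0. P (g x)"
  by (rule eventually_nhds_compose)
     (use assms smooth_near_isCont in \<open>auto simp: smooth_germs_iff\<close>)

lemma diffeo_germsE:
  assumes "f \<in> diffeo_germs"
  obtains g where "g \<in> diffeo_germs" "\<forall>\<^sub>F x in nhds 0. g (f x) = x" "\<forall>\<^sub>F x in nhds 0. f (g x) = x"
  using assms by (auto simp: diffeo_germs_def)

lemma diffeo_germs_compose:
  fixes f g :: "'a::euclidean_space \<Rightarrow> 'a"
  assumes f: "f \<in> diffeo_germs" and g: "g \<in> diffeo_germs"
  shows "(\<lambda>x. f (g x)) \<in> diffeo_germs"
proof -
  obtain f' where f': "f' \<in> diffeo_germs" "\<forall>\<^sub>F x in nhds 0. f' (f x) = x" "\<forall>\<^sub>F x in nhds 0. f (f' x) = x"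
    using diffeo_germsE[OF f] .
  obtain g' where g': "g' \<in> diffeo_germs" "\<forall>\<^sub>F x in nhds 0. g' (g x) = x" "\<forall>\<^sub>F x in nhds 0. g (g' x) = x"
    using diffeo_germsE[OF g] .
  note sm = diffeo_germsD(1)[OF f] diffeo_germsD(1)[OF g] diffeo_germsD(1)[OF f'(1)] diffeo_germsD(1)[OF g'(1)]
  have "\<forall>\<^sub>F x in nhds 0. g' (f' (f (g x))) = x"
    using eventually_nhds_0_compose[OF sm(2) f'(2)] g'(2) by eventually_elim simp
  moreover have "\<forall>\<^sub>F x in nhds 0. f (g (g' (f' x))) = x"
    using eventually_nhds_0_compose[OF sm(3) g'(3)] f'(3) by eventually_elim simp
  ultimately show ?thesis
    unfolding diffeo_germs_def mem_Collect_eq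
    by (intro conjI bexI[where x="\<lambda>x. g' (f' x)"])
       (assumption | rule smooth_germs_compose[OF sm(1,2)] smooth_germs_compose[OF sm(4,3)])+
qed

lemma matrix_diffeo_germ:
  fixes A :: "real^'n^'n"
  assumes "det A \<noteq> 0"
  shows "(\<lambda>x. A *v x) \<in> diffeo_germs"
proof -
  have sm: "(\<lambda>x. B *v x) \<in> smooth_germs" for B :: "real^'n^'n"
    by (simp add: smooth_germs_iff smooth_near_bounded_linear matrix_vector_mul_bounded_linear)
  obtain B where "A ** B = mat 1" "B ** A = mat 1"
    using assms invertible_det_nz[of A] by (auto simp: invertible_def)
  then have "A *v (B *v x) = x" "B *v (A *v x) = x" for x
    by (simp_all add: matrix_vector_mul_assoc)
  then show ?thesis
    unfolding diffeo_germs_def by (auto intro!: sm bexI[OF _ sm[of B]])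
qed

lemma id_diffeo_germ: "(\<lambda>x :: real^'n. x) \<in> diffeo_germs"
  using matrix_diffeo_germ[of "mat 1"] by simp

definition jac :: "(real^'n \<Rightarrow> real^'m) \<Rightarrow> real^'n^'m" where
  "jac f = matrix (frechet_derivative f (at 0))"

lemma jac_mult_vec: "smooth_near 0 f \<Longrightarrow> jac f *v v = frechet_derivative f (at 0) v"
  unfolding jac_def
  by (metis linear_frechet_derivative matrix_works smooth_near_differentiable
      linear_matrix_vector_mul_eq)

lemma jac_component: "jac f $ i $ j = frechet_derivative f (at 0) (axis j 1) $ i"
  by (simp add: jac_def matrix_def)

lemma jac_cong: "\<forall>\<^sub>F x in nhds 0. f x = g x \<Longrightarrow> jac f = jac g"
  by (simp add: jac_def frechet_derivative_cong_eventually)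

lemma jac_matrix: "jac (\<lambda>x. A *v x) = A"
proof -
  have "frechet_derivative (\<lambda>x. A *v x) (at 0) = (\<lambda>x. A *v x)"
    by (metis bounded_linear_imp_has_derivative frechet_derivative_at matrix_vector_mul_bounded_linear)
  then show ?thesis by (simp add: jac_def)
qed

lemma jac_id: "jac (\<lambda>x. x) = mat 1"
  using jac_matrix[of "mat 1"] by simp

lemma jac_compose:
  assumes "f \<in> smooth_germs" "g \<in> smooth_germs"
  shows "jac (\<lambda>x. f (g x)) = jac f ** jac g"
proof -
  have d: "g differentiable (at 0)" "f differentiable (at (g 0))"
    using assms by (auto simp: smooth_germs_iff smooth_near_differentiable)
  have "frechet_derivative (f \<circ> g) (at 0) = frechet_derivative f (at 0) \<circ> frechet_derivative g (at 0)"
    using frechet_derivative_compose[OF d] assms by (simp add: smooth_germs_iff)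
  then show ?thesis
    unfolding jac_def using d assms
    by (simp add: comp_def matrix_compose[unfolded comp_def] linear_frechet_derivative smooth_germs_iff)
qed

lemma jac_jet_eq:
  assumes "jet_eq r f g" "1 \<le> r"
  shows "jac f = jac g"
proof -
  have "jet_eq (Suc 0) f g" using assms by (auto intro: jet_eq_mono)
  then have "frechet_derivative f (at 0) (axis j 1) = frechet_derivative g (at 0) (axis j 1)" for j
    by (simp add: jet_eq_Suc jet_eq_0 axis_in_Basis_iff)
  then show ?thesis by (simp add: vec_eq_iff jac_component)
qed

lemma det_jac_inverse:
  assumes "f \<in> diffeo_germs" "g \<in> diffeo_germs" "\<forall>\<^sub>F x in nhds 0. g (f x) = x"
  shows "det (jac g) * det (jac f) = 1"
proof -
  have "jac g ** jac f = mat 1"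
    using jac_compose[of g f] jac_cong[OF assms(3)] assms(1,2) by (simp add: diffeo_germsD jac_id)
  then show ?thesis by (metis det_I det_mul)
qed

lemma det_jac_nonzero:
  assumes "f \<in> diffeo_germs"
  shows "det (jac f) \<noteq> 0"
proof -
  obtain g where "g \<in> diffeo_germs" "\<forall>\<^sub>F x in nhds 0. g (f x) = x"
    by (rule diffeo_germsE[OF assms])
  from det_jac_inverse[OF assms this] show ?thesis by auto
qed

lemma det_jac_compose:
  "f \<in> diffeo_germs \<Longrightarrow> g \<in> diffeo_germs \<Longrightarrow> det (jac (\<lambda>x. f (g x))) = det (jac f) * det (jac g)"
  by (simp add: jac_compose diffeo_germsD det_mul)

section \<open>The components of the space of jets of diffeomorphism germs\<close>

lemma iter_deriv_const: "iter_deriv (\<lambda>x. c) vs = (\<lambda>x. if vs = [] then c else 0)"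
  by (induction vs) auto

lemma iter_deriv_bounded_linear:
  assumes "bounded_linear L"
  shows "iter_deriv L vs 0 = (if length vs = 1 then L (hd vs) else 0)"
proof (cases vs rule: rev_cases)
  case Nil
  then show ?thesis using assms by (simp add: linear_simps)
next
  case (snoc us v)
  have "dderiv L v = (\<lambda>x. L v)"
    by (rule ext) (metis assms bounded_linear_imp_has_derivative frechet_derivative_at)
  then show ?thesis using snoc by (auto simp: iter_deriv_append iter_deriv_const)
qed

text \<open>Stated at every x with t x in U, not only at 0, because each further differentiation
  needs the formula on a neighbourhood.\<close>

lemma iter_deriv_rescale:
  assumes "open U" "smooth_on U f" "t *\<^sub>R x \<in> U"
  shows "iter_deriv (\<lambda>x. c *\<^sub>R f (t *\<^sub>R x)) vs x = (c * t ^ length vs) *\<^sub>R iter_deriv f vs (t *\<^sub>R x)"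
  using assms(3)
proof (induction vs arbitrary: x)
  case (Cons v vs)
  have op: "open ((\<lambda>x. t *\<^sub>R x) -` U)"
    by (intro open_vimage assms(1) continuous_intros)
  have "\<forall>\<^sub>F y in nhds x. iter_deriv (\<lambda>x. c *\<^sub>R f (t *\<^sub>R x)) vs y
      = (c * t ^ length vs) *\<^sub>R iter_deriv f vs (t *\<^sub>R y)"
    using eventually_nhds_in_open[OF op, of x] Cons.prems
    by (auto elim!: eventually_mono intro: Cons.IH)
  then have "iter_deriv (\<lambda>x. c *\<^sub>R f (t *\<^sub>R x)) (v # vs) x
      = frechet_derivative (\<lambda>y. (c * t ^ length vs) *\<^sub>R iter_deriv f vs (t *\<^sub>R y)) (at x) v"
    by (simp add: frechet_derivative_cong_eventually)
  also have "((\<lambda>y. (c * t ^ length vs) *\<^sub>R iter_deriv f vs (t *\<^sub>R y)) has_derivative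
      (\<lambda>v. (c * t ^ length vs) *\<^sub>R frechet_derivative (iter_deriv f vs) (at (t *\<^sub>R x)) (t *\<^sub>R v))) (at x)"
  proof -
    have "(iter_deriv f vs has_derivative frechet_derivative (iter_deriv f vs) (at (t *\<^sub>R x))) (at (t *\<^sub>R x))"
      using assms(2) Cons.prems by (simp add: smooth_on_def flip: frechet_derivative_works)
    moreover have "((\<lambda>y. t *\<^sub>R y) has_derivative (\<lambda>v. t *\<^sub>R v)) (at x)"
      by (intro derivative_intros)
    ultimately show ?thesis
      using diff_chain_at[of "\<lambda>y. t *\<^sub>R y" _ x "iter_deriv f vs"]
      by (intro has_derivative_scaleR_right) (simp add: comp_def)
  qed
  then have "frechet_derivative (\<lambda>y. (c * t ^ length vs) *\<^sub>R iter_deriv f vs (t *\<^sub>R y)) (at x) v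
      = (c * t ^ length vs) *\<^sub>R frechet_derivative (iter_deriv f vs) (at (t *\<^sub>R x)) (t *\<^sub>R v)"
    by (metis frechet_derivative_at)
  also have "\<dots> = (c * t ^ length (v # vs)) *\<^sub>R iter_deriv f (v # vs) (t *\<^sub>R x)"
  proof -
    have "linear (frechet_derivative (iter_deriv f vs) (at (t *\<^sub>R x)))"
      using assms(2) Cons.prems by (intro linear_frechet_derivative) (simp add: smooth_on_def)
    then show ?thesis by (simp add: linear_cmul mult_ac)
  qed
  finally show ?case .
qed simp

text \<open>The factor (1/t) t^l is t^(l-1). For the empty list, truncated subtraction gives the
  factor 1, which is harmless as f 0 = 0. The right-hand side stays meaningful at t = 0.\<close>

lemma jet_rescale:
  fixes f :: "'a::euclidean_space \<Rightarrow> 'b::real_normed_vector"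
  assumes "f \<in> smooth_germs" "t \<noteq> 0"
  shows "jet r (\<lambda>x. (1/t) *\<^sub>R f (t *\<^sub>R x)) = (\<lambda>vs. t ^ (length vs - 1) *\<^sub>R jet r f vs)"
proof
  fix vs :: "'a list"
  obtain U where U: "open U" "0 \<in> U" "smooth_on U f"
    using assms(1) by (auto simp: smooth_germs_def)
  have "iter_deriv (\<lambda>x. (1/t) *\<^sub>R f (t *\<^sub>R x)) vs 0 = t ^ (length vs - 1) *\<^sub>R iter_deriv f vs 0"
    using iter_deriv_rescale[OF U(1,3), of t 0 "1/t" vs] U(2) assms
    by (cases vs) (auto simp: smooth_germs_iff)
  then show "jet r (\<lambda>x. (1/t) *\<^sub>R f (t *\<^sub>R x)) vs = t ^ (length vs - 1) *\<^sub>R jet r f vs"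
    by (simp add: jet_def)
qed

text \<open>This is the preceding formula at t = 0: the factor \<open>0 ^ (length vs - 1)\<close> is
  1 on lists of length at most one and kills all higher derivatives.\<close>

lemma jet_jac:
  fixes f :: "real^'n \<Rightarrow> real^'m"
  assumes "f \<in> smooth_germs"
  shows "jet r (\<lambda>x. jac f *v x) = (\<lambda>vs. 0 ^ (length vs - 1) *\<^sub>R jet r f vs)"
proof
  fix vs :: "(real^'n) list"
  have "iter_deriv (\<lambda>x. jac f *v x) vs 0 = 0 ^ (length vs - 1) *\<^sub>R iter_deriv f vs 0"
  proof -
    consider "vs = []" | v where "vs = [v]" | u v ws where "vs = u # v # ws"
      by (metis neq_Nil_conv)
    moreover have lin: "iter_deriv (\<lambda>x. jac f *v x) vs 0 = (if length vs = 1 then jac f *v hd vs else 0)"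
      by (rule iter_deriv_bounded_linear) (rule matrix_vector_mul_bounded_linear)
    ultimately show ?thesis
      unfolding lin using assms by cases (auto simp: smooth_germs_iff jac_mult_vec)
  qed
  then show "jet r (\<lambda>x. jac f *v x) vs = 0 ^ (length vs - 1) *\<^sub>R jet r f vs"
    by (simp add: jet_def)
qed

lemma rescale_diffeo_germ:
  fixes f :: "'a::euclidean_space \<Rightarrow> 'a"
  assumes "f \<in> diffeo_germs" "t \<noteq> 0"
  shows "(\<lambda>x. (1/t) *\<^sub>R f (t *\<^sub>R x)) \<in> diffeo_germs"
proof -
  have lin: "(\<lambda>x::'a. c *\<^sub>R x) \<in> smooth_germs" for c
    by (simp add: smooth_germs_iff smooth_near_bounded_linear bounded_linear_scaleR_right)
  have "(\<lambda>x::'a. c *\<^sub>R x) \<in> diffeo_germs" if "c \<noteq> 0" for c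
    unfolding diffeo_germs_def using that by (auto intro!: lin bexI[OF _ lin[of "1/c"]])
  then show ?thesis
    using diffeo_germs_compose[of "\<lambda>x. (1/t) *\<^sub>R x" "\<lambda>x. f (t *\<^sub>R x)"]
      diffeo_germs_compose[of f "\<lambda>x. t *\<^sub>R x"] assms by simp
qed

lemma path_componentE:
  fixes S :: "'a::topological_space set"
  assumes "path_component S x y"
  obtains p :: "real \<Rightarrow> 'a" where "continuous_on {0..1} p" "\<forall>t\<in>{0..1}. p t \<in> S"
    "p 0 = x" "p 1 = y"
proof -
  obtain p where "path p" "path_image p \<subseteq> S" "pathstart p = x" "pathfinish p = y"
    using assms unfolding path_component_def by (elim exE conjE)
  then show ?thesis
    by (intro that[of p]) (auto simp: path_def path_image_def pathstart_def pathfinish_def)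
qed

lemma path_componentI:
  fixes S :: "'a::topological_space set" and p :: "real \<Rightarrow> 'a"
  assumes "continuous_on {0..1} p" "\<And>t. t \<in> {0..1} \<Longrightarrow> p t \<in> S" "p 0 = x" "p 1 = y"
  shows "path_component S x y"
  unfolding path_component_def path_def path_image_def pathstart_def pathfinish_def
  by (intro exI[of _ p]) (use assms in auto)

text \<open>The path is given by the jets of \<open>x \<mapsto> f (t x) / t\<close>.\<close>

lemma path_component_jet_jac:
  fixes f :: "real^'n \<Rightarrow> real^'n"
  assumes "f \<in> diffeo_germs"
  shows "path_component (Diff_jets r) (jet r (\<lambda>x. jac f *v x)) (jet r f)"
proof -
  \<comment> \<open>Written in jet coordinates, the path is monomial in t and hence continuous also
    at t = 0, where the rescaled germ is replaced by the linear part.\<close>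
  define p where "p = (\<lambda>t::real. \<lambda>vs. t ^ (length vs - 1) *\<^sub>R jet r f vs)"
  have p0: "p 0 = jet r (\<lambda>x. jac f *v x)"
    using jet_jac[of f r] diffeo_germsD[OF assms] by (simp add: p_def)
  have pt: "p t = jet r (\<lambda>x. (1/t) *\<^sub>R f (t *\<^sub>R x))" if "t \<noteq> 0" for t
    using jet_rescale[of f t r] diffeo_germsD[OF assms] that by (simp add: p_def)
  have p1: "p 1 = jet r f" by (simp add: p_def)
  have c: "continuous_on {0..1} p"
    unfolding p_def by (intro continuous_on_coordinatewise_then_product continuous_intros)
  have "p t \<in> Diff_jets r" for t
    using p0 pt[of t] assms det_jac_nonzero
    by (cases "t = 0") (auto simp: Diff_jets_def intro!: imageI rescale_diffeo_germ matrix_diffeo_germ)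
  from path_componentI[OF c this p0 p1] show ?thesis .
qed

section \<open>The two path components of the general linear group\<close>

abbreviation GL :: "(real^'n^'n) set" where "GL \<equiv> {A. det A \<noteq> 0}"

lemma continuous_on_det:
  fixes A :: "'a::topological_space \<Rightarrow> real^'n^'n"
  assumes "\<And>i j. continuous_on S (\<lambda>t. A t $ i $ j)"
  shows "continuous_on S (\<lambda>t. det (A t))"
  unfolding det_def by (intro continuous_intros assms)

lemma continuous_on_matrix:
  fixes A :: "'a::topological_space \<Rightarrow> real^'n^'m"
  assumes "\<And>i j. continuous_on S (\<lambda>t. A t $ i $ j)"
  shows "continuous_on S A"
proof -
  have "continuous_on S (\<lambda>t. \<chi> i. \<chi> j. A t $ i $ j)"
    by (intro continuous_on_vec_lambda assms)
  then show ?thesis by simp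
qed

lemma nonvanishing_path_sign:
  fixes d :: "real \<Rightarrow> real"
  assumes "continuous_on {0..1} d" "\<And>t. t \<in> {0..1} \<Longrightarrow> d t \<noteq> 0"
  shows "d 0 > 0 \<longleftrightarrow> d 1 > 0"
proof (rule ccontr)
  assume "\<not> ?thesis"
  then have "d 0 \<le> 0 \<and> 0 \<le> d 1 \<or> d 1 \<le> 0 \<and> 0 \<le> d 0" by linarith
  then obtain t where "0 \<le> t" "t \<le> 1" "d t = 0"
    using IVT'[of d 0 0 1] IVT2'[of d 1 0 0] assms(1) by auto
  then show False using assms(2) by auto
qed

lemma path_component_GL_sign:
  assumes "path_component GL A B"
  shows "det A > 0 \<longleftrightarrow> det B > 0"
proof -
  obtain p :: "real \<Rightarrow> _" where p: "continuous_on {0..1} p" "\<forall>t\<in>{0..1}. p t \<in> GL" "p 0 = A" "p 1 = B"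
    using path_componentE[OF assms] .
  note c = p(1)
  have "continuous_on {0..1} (\<lambda>t. det (p t))"
    by (intro continuous_on_det continuous_on_component c)
  then have "det (p 0) > 0 \<longleftrightarrow> det (p 1) > 0"
    by (intro nonvanishing_path_sign[of "\<lambda>t. det (p t)"]) (use p(2) in auto)
  then show ?thesis by (simp add: p)
qed

lemma path_component_Diff_jets_sign:
  fixes f :: "real^'n \<Rightarrow> real^'n"
  assumes "path_component (Diff_jets r) (jet r (\<lambda>x. x)) (jet r f)" "1 \<le> r"
  shows "det (jac f) > 0"
proof -
  obtain p :: "real \<Rightarrow> _" where p: "continuous_on {0..1} p" "\<forall>t\<in>{0..1}. p t \<in> Diff_jets r"
    "p 0 = jet r (\<lambda>x. x)" "p 1 = jet r f"
    using path_componentE[OF assms(1)] .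
  \<comment> \<open>\<open>J\<close> reads the Jacobian matrix off the entries of a jet at
    one-element lists, which are present as r is at least 1. Being made of coordinates, it is
    continuous in the jet.\<close>
  define J :: "((real^'n) list \<Rightarrow> real^'n) \<Rightarrow> real^'n^'n" where "J q = (\<chi> i j. q [axis j 1] $ i)" for q
  have J: "J (jet r g) = jac g" for g
    using assms(2) by (simp add: J_def vec_eq_iff jet_def jac_component axis_in_Basis_iff)
  note c = p(1)
  have "continuous_on {0..1} (\<lambda>t. det (J (p t)))"
  proof (rule continuous_on_det)
    show "continuous_on {0..1} (\<lambda>t. J (p t) $ i $ j)" for i j
      unfolding J_def vec_lambda_beta
      by (rule continuous_on_component, rule continuous_on_product_then_coordinatewise, rule c)
  qed
  moreover have "det (J (p t)) \<noteq> 0" if "t \<in> {0..1}" for t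
  proof -
    from bspec[OF p(2) that] show ?thesis by (auto simp: Diff_jets_def J det_jac_nonzero)
  qed
  ultimately have "det (J (p 0)) > 0 \<longleftrightarrow> det (J (p 1)) > 0"
    by (rule nonvanishing_path_sign[of "\<lambda>t. det (J (p t))"])
  then show ?thesis by (simp add: p J jac_id)
qed

lemma path_component_GL_mult:
  assumes "path_component GL A B" "path_component GL C D"
  shows "path_component GL (A ** C) (B ** D)"
proof -
  obtain p :: "real \<Rightarrow> _" where p: "continuous_on {0..1} p" "\<forall>t\<in>{0..1}. p t \<in> GL" "p 0 = A" "p 1 = B"
    using path_componentE[OF assms(1)] .
  obtain q :: "real \<Rightarrow> _" where q: "continuous_on {0..1} q" "\<forall>t\<in>{0..1}. q t \<in> GL" "q 0 = C" "q 1 = D"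
    using path_componentE[OF assms(2)] .
  note c = p(1) q(1)
  show ?thesis
  proof (rule path_componentI)
    show "continuous_on {0..1} (\<lambda>t. p t ** q t)"
    proof (rule continuous_on_matrix)
      show "continuous_on {0..1} (\<lambda>t. (p t ** q t) $ i $ j)" for i j
        unfolding matrix_matrix_mult_def vec_lambda_beta
        by (intro continuous_intros continuous_on_component c)
    qed
    show "p t ** q t \<in> GL" if "t \<in> {0..1}" for t
      using bspec[OF p(2) that] bspec[OF q(2) that] by (simp add: det_mul)
  qed (simp_all add: p q)
qed

text \<open>Householder reflection in the hyperplane orthogonal to u. It is continuous in u away
  from 0 and depends only on the line of u, which makes it easy to join coordinate sign changes and
  transpositions by paths.\<close>

definition reflection :: "real^'n \<Rightarrow> real^'n^'n" where
  "reflection u = (\<chi> i j. (if i = j then 1 else 0) - 2 * u $ i * u $ j / (u \<bullet> u))"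

lemma reflection_involution:
  assumes "u \<noteq> 0"
  shows "reflection u ** reflection u = mat 1"
proof -
  define r where "r = 2 / (u \<bullet> u)"
  have r: "r * r * (u \<bullet> u) = 2 * r"
    using assms by (simp add: r_def)
  have refl: "reflection u $ i $ j = (if i = j then 1 else 0) - r * u $ i * u $ j" for i j
    by (simp add: reflection_def r_def)
  have "(reflection u ** reflection u) $ i $ j = mat 1 $ i $ j" for i j
  proof -
    have "(reflection u ** reflection u) $ i $ j
      = (\<Sum>k\<in>UNIV. (if i = k then (if k = j then 1 else 0) else 0) - (if i = k then r * u $ k * u $ j else 0)
          - (if k = j then r * u $ i * u $ k else 0) + r * r * u $ i * u $ j * (u $ k * u $ k))"
      unfolding matrix_matrix_mult_def vec_lambda_beta refl by (rule sum.cong) (auto simp: algebra_simps)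
    also have "\<dots> = (if i = j then 1 else 0) - 2 * (r * u $ i * u $ j) + r * r * u $ i * u $ j * (u \<bullet> u)"
      by (simp add: sum.distrib sum_subtractf inner_vec_def flip: sum_distrib_left)
    also have "r * r * u $ i * u $ j * (u \<bullet> u) = 2 * r * u $ i * u $ j"
      using r by (metis mult.assoc mult.commute)
    finally show ?thesis by (simp add: mat_def)
  qed
  then show ?thesis by (simp add: vec_eq_iff)
qed

lemma reflection_GL: "u \<noteq> 0 \<Longrightarrow> reflection u \<in> GL"
  using det_mul[of "reflection u" "reflection u"] reflection_involution[of u] by auto

lemma reflection_scale: "c \<noteq> 0 \<Longrightarrow> reflection (c *\<^sub>R u) = reflection u"
  by (simp add: reflection_def vec_eq_iff)

text \<open>The segment from u to v avoids 0 unless v is a negative multiple of u, and in that case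
  both reflections coincide.\<close>

lemma path_component_reflections:
  fixes u v :: "real^'n"
  assumes "u \<noteq> 0" "v \<noteq> 0"
  shows "path_component GL (reflection u) (reflection v)"
proof (cases "0 \<in> closed_segment u v")
  case True
  then obtain s where s: "0 = (1 - s) *\<^sub>R u + s *\<^sub>R v" by (auto simp: in_segment)
  with assms have "s \<noteq> 0" "s \<noteq> 1" by auto
  have "s *\<^sub>R v = (s - 1) *\<^sub>R u"
    using s by (simp add: algebra_simps)
  then have "reflection (s *\<^sub>R v) = reflection ((s - 1) *\<^sub>R u)" by simp
  then have "reflection v = reflection u"
    using \<open>s \<noteq> 0\<close> \<open>s \<noteq> 1\<close> by (simp add: reflection_scale)
  then show ?thesis using reflection_GL[OF assms(1)] by (metis path_component_refl)
next
  case False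
  define p where "p = linepath u v"
  have nz: "p t \<noteq> 0" if "t \<in> {0..1}" for t
    using False that path_image_linepath[of u v] by (auto simp: p_def path_image_def)
  have c: "continuous_on {0..1} p" by (simp add: p_def flip: path_def)
  show ?thesis
  proof (rule path_componentI)
    show "continuous_on {0..1} (\<lambda>t. reflection (p t))"
    proof (rule continuous_on_matrix)
      show "continuous_on {0..1} (\<lambda>t. reflection (p t) $ i $ j)" for i j
        unfolding reflection_def vec_lambda_beta
        by (intro continuous_intros continuous_on_component c) (use nz in auto)
    qed
    show "reflection (p t) \<in> GL" if "t \<in> {0..1}" for t
      by (rule reflection_GL[OF nz[OF that]])
  qed (simp_all add: p_def linepath_def)
qed

definition flip :: "'n set \<Rightarrow> real^'n^'n" where
  "flip N = (\<chi> i j. if i = j then (if i \<in> N then -1 else 1) else 0)"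

lemma det_flip: "det (flip N) = (-1) ^ card N"
proof -
  have "det (flip N) = (\<Prod>i\<in>UNIV. if i \<in> N then -1 else 1)"
    by (subst det_diagonal) (auto simp: flip_def)
  also have "\<dots> = (\<Prod>i\<in>N. -1)"
    by (simp add: prod.If_cases)
  finally show ?thesis by simp
qed

lemma flip_mult: "flip M ** flip N = flip ((M - N) \<union> (N - M))"
  by (auto simp: vec_eq_iff matrix_matrix_mult_def flip_def if_distrib[of "\<lambda>x. x * _"] cong: if_cong)

lemma flip_empty: "flip {} = mat 1"
  by (simp add: flip_def mat_def vec_eq_iff)

lemma flip_singleton: "flip {i} = reflection (axis i 1)"
  unfolding flip_def reflection_def vec_eq_iff inner_axis_axis by (simp add: axis_def)

text \<open>Invertible matrices are products of diagonal matrices, transpositions and shears, and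
  being joined to \<open>mat 1\<close> or to the reference flip is stable under products because
  that flip is an involution.\<close>

lemma path_component_GL_flip:
  fixes A :: "real^'n^'n" and o' :: 'n
  assumes "det A \<noteq> 0"
  shows "path_component GL A (mat 1) \<or> path_component GL A (flip {o'})"
proof -
  let ?P = "\<lambda>A. path_component GL A (mat 1) \<or> path_component GL A (flip {o'})"
  have one: "?P (mat 1)" by (simp add: path_component_refl)
  have flip_sq: "flip {o'} ** flip {o'} = mat 1" by (simp add: flip_mult flip_empty)
  have mult: "?P (A ** B)" if "?P A" "?P B" for A B
    using that path_component_GL_mult[of A _ B] flip_sq
    by (metis matrix_mul_lid matrix_mul_rid)
  have refl: "?P (reflection u)" if "u \<noteq> 0" for u
    using path_component_reflections[of u "axis o' 1"] that by (simp add: flip_singleton axis_eq_0_iff)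
  have fl: "?P (flip N)" if "finite N" for N
    using that
  proof induction
    case empty
    then show ?case using one by (simp add: flip_empty)
  next
    case (insert i N)
    have "flip (insert i N) = flip {i} ** flip N"
      using insert by (auto simp: flip_mult intro: arg_cong[of _ _ flip])
    moreover have "?P (flip {i})" using refl[of "axis i 1"] by (simp add: flip_singleton axis_eq_0_iff)
    ultimately show ?case using mult insert by metis
  qed
  \<comment> \<open>The induction over elementary matrices also meets singular ones, hence the
    guard; a product is invertible only if both factors are.\<close>
  have "det A \<noteq> 0 \<longrightarrow> ?P A"
  proof (rule induct_matrix_elementary[where P="\<lambda>A. det A \<noteq> 0 \<longrightarrow> ?P A"])
    show "det (A ** B) \<noteq> 0 \<longrightarrow> ?P (A ** B)"
      if "det A \<noteq> 0 \<longrightarrow> ?P A" "det B \<noteq> 0 \<longrightarrow> ?P B" for A B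
      using that mult[of A B] unfolding det_mul by auto
  next
    show "det A \<noteq> 0 \<longrightarrow> ?P A" if "row i A = 0" for A i
      using det_zero_row(1)[OF that] by simp
  next
    fix A :: "real^'n^'n"
    assume diagonal: "\<And>i j. i \<noteq> j \<Longrightarrow> A $ i $ j = 0"
    show "det A \<noteq> 0 \<longrightarrow> ?P A"
    proof
      assume nz: "det A \<noteq> 0"
      have nzi: "A $ i $ i \<noteq> 0" for i
        using nz det_diagonal[of A] diagonal by auto
      \<comment> \<open>Along the segment to the sign matrix with the same negative positions each
        diagonal entry keeps its sign, so none vanishes on the way.\<close>
      define N where "N = {i. A $ i $ i < 0}"
      define p where "p = linepath A (flip N)"
      have pd: "p t $ i $ j = (if i = j then (1 - t) * A $ i $ i + t * (if i \<in> N then -1 else 1) else 0)" for t i j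
        using diagonal by (auto simp: p_def linepath_def flip_def)
      have pnz: "det (p t) \<noteq> 0" if "0 \<le> t" "t \<le> 1" for t
      proof -
        have "(1 - t) * A $ i $ i + t * (if i \<in> N then -1 else 1) \<noteq> 0" for i
        proof (cases "i \<in> N")
          case True
          then have "A $ i $ i < 0" by (simp add: N_def)
          then have "(1 - t) * A $ i $ i - t < 0"
            using that by (cases "t = 0") (auto intro!: add_nonpos_neg simp: mult_nonneg_nonpos diff_conv_add_uminus simp del: add_uminus_conv_diff)
          then show ?thesis using True by simp
        next
          case False
          then have "A $ i $ i > 0" using nzi[of i] by (simp add: N_def)
          then have "(1 - t) * A $ i $ i + t > 0"
            using that by (cases "t = 0") (auto intro!: add_nonneg_pos)
          then show ?thesis using False by simp
        qed
        then show ?thesis by (subst det_diagonal) (simp_all add: pd)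
      qed
      have "path_component GL A (flip N)"
      proof (rule path_componentI)
        show "continuous_on {0..1} p" by (simp add: p_def flip: path_def)
        show "p t \<in> GL" if "t \<in> {0..1}" for t using pnz that by simp
      qed (simp_all add: p_def linepath_def)
      then show "?P A" using fl[OF finite[of N]] path_component_trans by blast
    qed
  next
    fix m n :: 'n assume swap1: "m \<noteq> n"
    \<comment> \<open>A transposition is the reflection along e_m - e_n; the squared length 2
      cancels the factor 2 in \<open>reflection\<close>.\<close>
    have "(axis m 1 - axis n 1) \<bullet> (axis m 1 - axis n 1 :: real^'n) = 2"
      using swap1 by (simp add: inner_diff_left inner_diff_right inner_axis_axis)
    then have "(\<chi> i j. mat 1 $ i $ Transposition.transpose m n j) = reflection (axis m 1 - axis n 1 :: real^'n)"
      unfolding reflection_def using swap1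
      by (auto simp: vec_eq_iff mat_def axis_def Transposition.transpose_def)
    moreover have "axis m 1 - axis n 1 \<noteq> (0 :: real^'n)"
      using swap1 by (simp add: axis_eq_axis)
    ultimately have "?P (\<chi> i j. mat 1 $ i $ Transposition.transpose m n j)"
      using refl by metis
    then show "det (\<chi> i j. mat 1 $ i $ Transposition.transpose m n j :: real^'n^'n) \<noteq> 0
        \<longrightarrow> ?P (\<chi> i j. mat 1 $ i $ Transposition.transpose m n j)" ..
  next
    fix m n :: 'n and c :: real assume idplus: "m \<noteq> n"
    define E where "E c = (\<chi> i j. if i = m \<and> j = n then c else of_bool (i = j) :: real^'n^'n)" for c :: real
    have detE: "det (E c) = 1" for c
    proof -
      have "E c = (\<chi> k. if k = m then row m (mat 1) + c *s row n (mat 1) else row k (mat 1))"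
        using idplus by (auto simp: E_def vec_eq_iff row_def mat_def)
      then show ?thesis using det_row_operation[OF idplus, of "mat 1" c] by simp
    qed
    \<comment> \<open>Shrinking the off-diagonal entry of a shear to 0 keeps the determinant equal
      to 1.\<close>
    have "path_component GL (E 0) (E c)"
    proof (rule path_componentI)
      show "continuous_on {0..1} (\<lambda>t. E (t * c))"
      proof (rule continuous_on_matrix)
        show "continuous_on {0..1} (\<lambda>t. E (t * c) $ i $ j)" for i j
          by (cases "i = m \<and> j = n") (auto simp: E_def intro!: continuous_intros)
      qed
    qed (simp_all add: detE)
    moreover have "E 0 = mat 1" using idplus by (auto simp: E_def vec_eq_iff mat_def)
    ultimately have "?P (E c)" using path_component_sym by metis
    then show "det (\<chi> i j. if i = m \<and> j = n then c else of_bool (i = j) :: real^'n^'n) \<noteq> 0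
        \<longrightarrow> ?P (\<chi> i j. if i = m \<and> j = n then c else of_bool (i = j))"
      unfolding E_def ..
  qed
  then show ?thesis using assms by blast
qed

lemma path_component_GL_mat_1:
  fixes A :: "real^'n^'n"
  assumes "det A > 0"
  shows "path_component GL (mat 1) A"
proof -
  have "\<not> path_component GL A (flip {i})" for i
    using path_component_GL_sign[of A "flip {i}"] assms det_flip[of "{i}"] by auto
  then show ?thesis using path_component_GL_flip[of A] assms path_component_sym by (metis less_irrefl)
qed

lemma path_component_jet_matrix:
  fixes A B :: "real^'n^'n"
  assumes "path_component GL A B"
  shows "path_component (Diff_jets r) (jet r (\<lambda>x. A *v x)) (jet r (\<lambda>x. B *v x))"
proof -
  obtain p :: "real \<Rightarrow> _" where p: "continuous_on {0..1} p" "\<forall>t\<in>{0..1}. p t \<in> GL" "p 0 = A" "p 1 = B"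
    using path_componentE[OF assms] .
  note c = p(1)
  have j: "jet r (\<lambda>x. C *v x) vs
      = (if length vs \<le> r \<and> set vs \<subseteq> Basis \<and> length vs = 1 then C *v hd vs else 0)"
    for C :: "real^'n^'n" and vs
    by (simp add: jet_def iter_deriv_bounded_linear matrix_vector_mul_bounded_linear)
  have "continuous_on {0..1} (\<lambda>t. p t *v v)" for v
    unfolding matrix_vector_mult_def by (intro continuous_intros continuous_on_component c)
  note cv = this
  show ?thesis
  proof (rule path_componentI)
    show "continuous_on {0..1} (\<lambda>t. jet r (\<lambda>x. p t *v x))"
    proof (rule continuous_on_coordinatewise_then_product)
      have "continuous_on {0..1} (\<lambda>t. if Q then p t *v v else 0)" for Q v
        by (cases Q) (simp_all add: cv)
      then show "continuous_on {0..1} (\<lambda>t. jet r (\<lambda>x. p t *v x) vs)" for vs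
        unfolding j .
    qed
    show "jet r (\<lambda>x. p t *v x) \<in> Diff_jets r" if "t \<in> {0..1}" for t
      unfolding Diff_jets_def using bspec[OF p(2) that] by (intro imageI matrix_diffeo_germ) auto
  qed (simp_all add: p)
qed

text \<open>A jet is joined to that of its linear part, and the linear part to the identity inside
  \<open>GL\<close>; conversely the Jacobian determinant cannot change sign along a path of
  jets.\<close>

lemma path_component_Diff_jets_iff:
  fixes f :: "real^'n \<Rightarrow> real^'n"
  assumes "f \<in> diffeo_germs" "1 \<le> r"
  shows "path_component (Diff_jets r) (jet r (\<lambda>x. x)) (jet r f) \<longleftrightarrow> det (jac f) > 0"
proof
  assume "det (jac f) > 0"
  from path_component_jet_matrix[OF path_component_GL_mat_1[OF this], of r]
  show "path_component (Diff_jets r) (jet r (\<lambda>x. x)) (jet r f)"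
    using path_component_trans path_component_jet_jac[OF assms(1), of r] by simp blast
qed (use path_component_Diff_jets_sign assms in blast)

section \<open>Isotopy classes and orientation signs\<close>

lemma A_equivalentI:
  assumes "f \<in> smooth_germs" "g \<in> smooth_germs" "S \<in> diffeo_germs" "T \<in> diffeo_germs"
    "\<forall>\<^sub>F x in nhds 0. g x = T (f (S x))"
  shows "A_equivalent f g"
  unfolding A_equivalent_def by (intro conjI bexI[of _ S] bexI[of _ T] assms)

lemma A_equivalent_smooth:
  assumes "A_equivalent f g"
  shows "f \<in> smooth_germs" "g \<in> smooth_germs"
  using assms by (simp_all add: A_equivalent_def)

lemma A_equivalent_refl:
  fixes f :: "real^'n \<Rightarrow> real^'m"
  assumes "f \<in> smooth_germs"
  shows "A_equivalent f f"
  by (rule A_equivalentI[OF assms assms id_diffeo_germ id_diffeo_germ]) simp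

lemma A_equivalent_sym:
  fixes f g :: "real^'n \<Rightarrow> real^'m"
  assumes "A_equivalent f g"
  shows "A_equivalent g f"
proof -
  obtain s t where st: "s \<in> diffeo_germs" "t \<in> diffeo_germs" "\<forall>\<^sub>F x in nhds 0. g x = t (f (s x))"
    and sm: "f \<in> smooth_germs" "g \<in> smooth_germs"
    using assms by (auto simp: A_equivalent_def)
  obtain s' where s': "s' \<in> diffeo_germs" "\<forall>\<^sub>F x in nhds 0. s (s' x) = x"
    using diffeo_germsE[OF st(1)] .
  obtain t' where t': "t' \<in> diffeo_germs" "\<forall>\<^sub>F x in nhds 0. t' (t x) = x"
    using diffeo_germsE[OF st(2)] .
  have "\<forall>\<^sub>F x in nhds 0. f x = t' (g (s' x))"
    using eventually_nhds_0_compose[OF diffeo_germsD(1)[OF s'(1)] st(3)] s'(2)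
      eventually_nhds_0_compose[OF sm(1) t'(2)]
    by eventually_elim simp
  then show ?thesis by (rule A_equivalentI[OF sm(2,1) s'(1) t'(1)])
qed

lemma A_equivalent_trans:
  fixes f g :: "real^'n \<Rightarrow> real^'m"
  assumes "A_equivalent f g" "A_equivalent g h"
  shows "A_equivalent f h"
proof -
  obtain s t where st: "s \<in> diffeo_germs" "t \<in> diffeo_germs" "\<forall>\<^sub>F x in nhds 0. g x = t (f (s x))"
    using assms(1) by (auto simp: A_equivalent_def)
  obtain s' t' where st': "s' \<in> diffeo_germs" "t' \<in> diffeo_germs" "\<forall>\<^sub>F x in nhds 0. h x = t' (g (s' x))"
    using assms(2) by (auto simp: A_equivalent_def)
  have "\<forall>\<^sub>F x in nhds 0. h x = t' (t (f (s (s' x))))"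
    using st'(3) eventually_nhds_0_compose[OF diffeo_germsD(1)[OF st'(1)] st(3)]
    by eventually_elim simp
  then show ?thesis
    by (rule A_equivalentI[OF A_equivalent_smooth(1)[OF assms(1)] A_equivalent_smooth(2)[OF assms(2)]
          diffeo_germs_compose[OF st(1) st'(1)] diffeo_germs_compose[OF st'(2) st(2)]])
qed

text \<open>The Booleans record whether the source and the target diffeomorphism preserve orientation.\<close>

definition signed_jet_equiv ::
  "nat \<Rightarrow> bool \<Rightarrow> bool \<Rightarrow> (real^'n \<Rightarrow> real^'m) \<Rightarrow> (real^'n \<Rightarrow> real^'m) \<Rightarrow> bool" where
  "signed_jet_equiv r p q f g \<longleftrightarrow> (\<exists>S\<in>diffeo_germs. \<exists>T\<in>diffeo_germs.
     (det (jac S) > 0 \<longleftrightarrow> p) \<and> (det (jac T) > 0 \<longleftrightarrow> q) \<and> jet_eq r g (\<lambda>x. T (f (S x))))"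

lemma signed_jet_equivI:
  assumes "S \<in> diffeo_germs" "T \<in> diffeo_germs" "det (jac S) > 0 \<longleftrightarrow> p" "det (jac T) > 0 \<longleftrightarrow> q"
    "jet_eq r g (\<lambda>x. T (f (S x)))"
  shows "signed_jet_equiv r p q f g"
  unfolding signed_jet_equiv_def by (intro bexI[of _ S] bexI[of _ T] conjI assms)

lemma signed_jet_equivE:
  assumes "signed_jet_equiv r p q f g"
  obtains S T where "S \<in> diffeo_germs" "T \<in> diffeo_germs" "det (jac S) > 0 \<longleftrightarrow> p"
    "det (jac T) > 0 \<longleftrightarrow> q" "jet_eq r g (\<lambda>x. T (f (S x)))"
  using assms unfolding signed_jet_equiv_def by (elim bexE conjE)

lemma signed_jet_equiv_refl: "signed_jet_equiv r True True f f"
  by (rule signed_jet_equivI[OF id_diffeo_germ id_diffeo_germ]) (simp_all add: jac_id jet_eq_refl)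

lemma jet_eq_compose_germs:
  fixes S :: "real^'n \<Rightarrow> real^'n" and T :: "real^'m \<Rightarrow> real^'m"
  assumes f: "f \<in> smooth_germs" and g: "g \<in> smooth_germs"
    and S: "S \<in> diffeo_germs" and T: "T \<in> diffeo_germs" and fg: "jet_eq r f g"
  shows "jet_eq r (\<lambda>x. T (f (S x))) (\<lambda>x. T (g (S x)))"
proof -
  note sm = smooth_germsD[OF f] smooth_germsD[OF g] diffeo_germsD(2,3)[OF S] diffeo_germsD(2,3)[OF T]
  note fS = smooth_germsD(2)[OF smooth_germs_compose[OF f diffeo_germsD(1)[OF S]]]
    and gS = smooth_germsD(2)[OF smooth_germs_compose[OF g diffeo_germsD(1)[OF S]]]
  have "jet_eq r (\<lambda>x. f (S x)) (\<lambda>x. g (S x))"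
    by (rule jet_eq_compose[OF sm(5,5,2,6,4,6) fg jet_eq_refl])
  then show ?thesis
    by (intro jet_eq_compose[of "\<lambda>x. f (S x)" "\<lambda>x. g (S x)", OF _ _ sm(8) fS sm(8) gS jet_eq_refl])
       (simp_all add: sm)
qed

lemma signed_jet_equiv_sym:
  assumes "signed_jet_equiv r p q f g" "f \<in> smooth_germs" "g \<in> smooth_germs"
  shows "signed_jet_equiv r p q g f"
proof -
  obtain S T where ST: "S \<in> diffeo_germs" "T \<in> diffeo_germs" "det (jac S) > 0 \<longleftrightarrow> p"
    "det (jac T) > 0 \<longleftrightarrow> q" "jet_eq r g (\<lambda>x. T (f (S x)))"
    by (rule signed_jet_equivE[OF assms(1)])
  obtain S' where S': "S' \<in> diffeo_germs" "\<forall>\<^sub>F x in nhds 0. S' (S x) = x" "\<forall>\<^sub>F x in nhds 0. S (S' x) = x"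
    using diffeo_germsE[OF ST(1)] .
  obtain T' where T': "T' \<in> diffeo_germs" "\<forall>\<^sub>F x in nhds 0. T' (T x) = x"
    using diffeo_germsE[OF ST(2)] .
  have sm: "(\<lambda>x. T (f (S x))) \<in> smooth_germs"
    by (rule smooth_germs_compose[of T, OF diffeo_germsD(1)[OF ST(2)]
          smooth_germs_compose[of f, OF assms(2) diffeo_germsD(1)[OF ST(1)]]])
  have "jet_eq r (\<lambda>x. T' (g (S' x))) (\<lambda>x. T' (T (f (S (S' x)))))"
    by (rule jet_eq_compose_germs[OF assms(3) sm S'(1) T'(1) ST(5)])
  moreover have "jet_eq r (\<lambda>x. T' (T (f (S (S' x))))) f"
  proof (rule jet_eq_eventually)
    show "\<forall>\<^sub>F x in nhds 0. T' (T (f (S (S' x)))) = f x"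
      using S'(3) eventually_nhds_0_compose[OF assms(2) T'(2)] by eventually_elim simp
  qed
  ultimately have "jet_eq r f (\<lambda>x. T' (g (S' x)))"
    using jet_eq_sym jet_eq_trans by blast
  moreover have "det (jac S') > 0 \<longleftrightarrow> p" "det (jac T') > 0 \<longleftrightarrow> q"
    using det_jac_inverse[OF ST(1) S'(1,2)] det_jac_inverse[OF ST(2) T'] ST(3,4)
    by (metis zero_less_mult_pos zero_less_mult_pos2 zero_less_one)+
  ultimately show ?thesis
    by (intro signed_jet_equivI[OF S'(1) T'(1)])
qed

text \<open>Equality of Booleans is multiplication of signs, with \<open>True\<close> for
  orientation preserving.\<close>

lemma signed_jet_equiv_trans:
  assumes "signed_jet_equiv r p q f g" "signed_jet_equiv r p' q' g h"
    and "f \<in> smooth_germs" "g \<in> smooth_germs"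
  shows "signed_jet_equiv r (p = p') (q = q') f h"
proof -
  obtain S T where ST: "S \<in> diffeo_germs" "T \<in> diffeo_germs" "det (jac S) > 0 \<longleftrightarrow> p"
    "det (jac T) > 0 \<longleftrightarrow> q" "jet_eq r g (\<lambda>x. T (f (S x)))"
    by (rule signed_jet_equivE[OF assms(1)])
  obtain S' T' where ST': "S' \<in> diffeo_germs" "T' \<in> diffeo_germs" "det (jac S') > 0 \<longleftrightarrow> p'"
    "det (jac T') > 0 \<longleftrightarrow> q'" "jet_eq r h (\<lambda>x. T' (g (S' x)))"
    by (rule signed_jet_equivE[OF assms(2)])
  have sm: "(\<lambda>x. T (f (S x))) \<in> smooth_germs"
    by (rule smooth_germs_compose[of T, OF diffeo_germsD(1)[OF ST(2)]
          smooth_germs_compose[of f, OF assms(3) diffeo_germsD(1)[OF ST(1)]]])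
  have "jet_eq r h (\<lambda>x. T' (T (f (S (S' x)))))"
    using jet_eq_trans[OF ST'(5) jet_eq_compose_germs[OF assms(4) sm ST'(1,2) ST(5)]] .
  moreover have "det (jac (\<lambda>x. S (S' x))) > 0 \<longleftrightarrow> p = p'"
    using det_jac_nonzero[OF ST(1)] det_jac_nonzero[OF ST'(1)]
    by (auto simp: det_jac_compose ST(1) ST'(1) zero_less_mult_iff simp flip: ST(3) ST'(3))
  moreover have "det (jac (\<lambda>x. T' (T x))) > 0 \<longleftrightarrow> q = q'"
    using det_jac_nonzero[OF ST(2)] det_jac_nonzero[OF ST'(2)]
    by (auto simp: det_jac_compose ST(2) ST'(2) zero_less_mult_iff simp flip: ST(4) ST'(4))
  ultimately show ?thesis
    by (intro signed_jet_equivI[OF diffeo_germs_compose[OF ST(1) ST'(1)] diffeo_germs_compose[OF ST'(2) ST(2)]])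
qed

text \<open>The end points of paths of jets that start at the identity are exactly the jets with
  positive Jacobian determinant, so the paths can be traded for signs.\<close>

lemma A_isotopic_iff:
  fixes f g :: "real^'n \<Rightarrow> real^'m"
  assumes "1 \<le> r"
  shows "A_isotopic r f g \<longleftrightarrow> A_equivalent f g \<and> signed_jet_equiv r True True f g"
    (is "?L \<longleftrightarrow> ?R")
proof
  assume L: ?L
  then obtain \<sigma> \<tau> S T where
    "path \<sigma>" "path_image \<sigma> \<subseteq> Diff_jets r" "pathstart \<sigma> = jet r (\<lambda>x. x)" "pathfinish \<sigma> = jet r S"
    "path \<tau>" "path_image \<tau> \<subseteq> Diff_jets r" "pathstart \<tau> = jet r (\<lambda>x. x)" "pathfinish \<tau> = jet r T"
    and ST: "S \<in> diffeo_germs" "T \<in> diffeo_germs" "jet_eq r g (\<lambda>x. T (f (S x)))"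
    unfolding A_isotopic_def jet_eq_def by metis
  then have "path_component (Diff_jets r) (jet r (\<lambda>x. x)) (jet r S)"
    "path_component (Diff_jets r) (jet r (\<lambda>x. x)) (jet r T)"
    unfolding path_component_def by blast+
  then have "det (jac S) > 0" "det (jac T) > 0"
    using path_component_Diff_jets_iff ST assms by blast+
  then show ?R using L ST unfolding A_isotopic_def signed_jet_equiv_def by blast
next
  assume R: ?R
  then obtain S T where ST: "S \<in> diffeo_germs" "T \<in> diffeo_germs" "jet_eq r g (\<lambda>x. T (f (S x)))"
    and "det (jac S) > 0" "det (jac T) > 0"
    unfolding signed_jet_equiv_def by blast
  then have "path_component (Diff_jets r) (jet r (\<lambda>x. x)) (jet r S)"
    "path_component (Diff_jets r) (jet r (\<lambda>x. x)) (jet r T)"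
    using path_component_Diff_jets_iff assms by blast+
  then obtain \<sigma> \<tau> where
    "path \<sigma>" "path_image \<sigma> \<subseteq> Diff_jets r" "pathstart \<sigma> = jet r (\<lambda>x. x)" "pathfinish \<sigma> = jet r S"
    "path \<tau>" "path_image \<tau> \<subseteq> Diff_jets r" "pathstart \<tau> = jet r (\<lambda>x. x)" "pathfinish \<tau> = jet r T"
    unfolding path_component_def by (elim exE conjE)
  then show ?L
    unfolding A_isotopic_def using R ST unfolding jet_eq_def
    by (intro conjI exI[of _ \<sigma>] exI[of _ \<tau>] bexI[of _ S] bexI[of _ T]) simp_all
qed

lemma A_equivalent_imp_signed_jet_equiv:
  assumes "A_equivalent f g"
  shows "\<exists>p q. signed_jet_equiv r p q f g"
  using assms unfolding A_equivalent_def signed_jet_equiv_def by (blast intro: jet_eq_eventually)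

lemma A_orbit_eq: 
  fixes f g :: "real^'n \<Rightarrow> real^'m"
  shows "A_equivalent f g \<Longrightarrow> A_orbit f = A_orbit g"
  unfolding A_orbit_def using A_equivalent_sym A_equivalent_trans by blast

text \<open>A germ in the orbit of f for each prescribed pair of signs, obtained by reversing one
  source coordinate, one target coordinate, both or none.\<close>

definition orientation_rep ::
  "(real^'n \<Rightarrow> real^'m) \<Rightarrow> 'n \<Rightarrow> 'm \<Rightarrow> bool \<Rightarrow> bool \<Rightarrow> real^'n \<Rightarrow> real^'m" where
  "orientation_rep f i j p q x =
     flip (if q then {} else {j}) *v f (flip (if p then {} else {i}) *v x)"

lemma flip_diffeo_germ: "(\<lambda>x. flip N *v x) \<in> diffeo_germs"
  by (rule matrix_diffeo_germ) (simp add: det_flip)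

lemma orientation_rep_props:
  fixes f :: "real^'n \<Rightarrow> real^'m"
  assumes "f \<in> smooth_germs"
  shows "A_equivalent f (orientation_rep f i j p q)"
    and "signed_jet_equiv r p q f (orientation_rep f i j p q)"
proof -
  let ?S = "\<lambda>x. flip (if p then {} else {i}) *v x" and ?T = "\<lambda>x. flip (if q then {} else {j}) *v x"
  have sm: "orientation_rep f i j p q \<in> smooth_germs"
    unfolding orientation_rep_def
    by (rule smooth_germs_compose[of ?T, OF diffeo_germsD(1)[OF flip_diffeo_germ]
        smooth_germs_compose[of f, OF assms diffeo_germsD(1)[OF flip_diffeo_germ]]])
  show "A_equivalent f (orientation_rep f i j p q)"
    by (rule A_equivalentI[of _ _ ?S ?T, OF assms sm flip_diffeo_germ flip_diffeo_germ])
       (simp add: orientation_rep_def)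
  show "signed_jet_equiv r p q f (orientation_rep f i j p q)"
  proof (rule signed_jet_equivI[of ?S ?T, OF flip_diffeo_germ flip_diffeo_germ])
    show "jet_eq r (orientation_rep f i j p q) (\<lambda>x. ?T (f (?S x)))"
      unfolding orientation_rep_def by (rule jet_eq_refl)
  qed (simp_all add: jac_matrix det_flip)
qed

text \<open>The group of pairs of signs acts transitively on the isotopy classes in an orbit, and
  \<open>signed_jet_equiv r p q f f\<close> describes the stabiliser of the class of \<open>f\<close>.\<close>

lemma A_isotopy_classes_eq:
  fixes f :: "real^'n \<Rightarrow> real^'m" and r :: nat
  assumes f: "f \<in> smooth_germs" and r: "1 \<le> r"
  obtains K where "A_isotopy_classes r f = {K True True, K True False, K False True, K False False}"
    and "\<And>p q p' q'. K p q = K p' q' \<longleftrightarrow> signed_jet_equiv r (p = p') (q = q') f f"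
proof
  define R where "R = {(g, h). A_isotopic r g (h :: real^'n \<Rightarrow> real^'m)}"
  \<comment> \<open>Any source and target coordinate may be reversed, so the choice is left open as
    \<open>undefined\<close>.\<close>
  define rep where "rep = orientation_rep f undefined undefined"
  define K where "K p q = R `` {rep p q}" for p q
  note iso = A_isotopic_iff[OF r]
  note smooth = A_equivalent_smooth(2)
  have sym: "A_isotopic r h g" if "A_isotopic r g h" for g h :: "real^'n \<Rightarrow> real^'m"
    using that A_equivalent_sym[of g h] A_equivalent_smooth[of g h] signed_jet_equiv_sym[of r True True g h]
    unfolding iso by blast
  have trans: "A_isotopic r g l" if "A_isotopic r g h" "A_isotopic r h l" for g h l :: "real^'n \<Rightarrow> real^'m"
    using that A_equivalent_trans[of g h l] A_equivalent_smooth[of g h]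
      signed_jet_equiv_trans[of r True True g h True True l]
    unfolding iso by simp
  have refl: "A_isotopic r g g" if "A_equivalent f g" for g
    using smooth[OF that] signed_jet_equiv_refl A_equivalent_refl unfolding iso by blast
  have rep: "A_equivalent f (rep p q)" "signed_jet_equiv r p q f (rep p q)" for p q
    using orientation_rep_props[OF f] by (simp_all add: rep_def)
  \<comment> \<open>Germs reached from f with the same signs are isotopic: going back to f and
    forward again, the signs cancel.\<close>
  have iso_rep: "A_isotopic r (rep p q) g"
    if "A_equivalent f g" "signed_jet_equiv r p q f g" for p q g
  proof -
    have "signed_jet_equiv r p q (rep p q) f"
      by (rule signed_jet_equiv_sym[OF rep(2) f smooth[OF rep(1)]])
    from signed_jet_equiv_trans[OF this that(2) smooth[OF rep(1)] f]
    show ?thesis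
      unfolding iso using A_equivalent_trans[OF A_equivalent_sym[OF rep(1)] that(1)] by simp
  qed
  have class_eq: "R `` {g} = R `` {h} \<longleftrightarrow> A_isotopic r g h" if "A_equivalent f h" for g h
  proof
    assume "R `` {g} = R `` {h}"
    moreover have "h \<in> R `` {h}" using refl[OF that] by (simp add: R_def)
    ultimately have "h \<in> R `` {g}" by simp
    then show "A_isotopic r g h" by (simp add: R_def)
  next
    assume "A_isotopic r g h"
    then have "A_isotopic r g l \<longleftrightarrow> A_isotopic r h l" for l
      using sym[of g h] trans[of g h l] trans[of h g l] by blast
    then show "R `` {g} = R `` {h}" by (simp add: R_def Image_def)
  qed
  show "K p q = K p' q' \<longleftrightarrow> signed_jet_equiv r (p = p') (q = q') f f" for p q p' q'
  proof -
    have "K p q = K p' q' \<longleftrightarrow> A_isotopic r (rep p q) (rep p' q')"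
      unfolding K_def using class_eq rep by blast
    also have "\<dots> \<longleftrightarrow> signed_jet_equiv r (p = p') (q = q') f f"
    proof
      assume "A_isotopic r (rep p q) (rep p' q')"
      then have "signed_jet_equiv r p q f (rep p' q')"
        using signed_jet_equiv_trans[OF rep(2)[of p q], of True True] f smooth[OF rep(1)]
        unfolding iso by simp
      then show "signed_jet_equiv r (p = p') (q = q') f f"
        using signed_jet_equiv_trans[of r p q f _ p' q' f] signed_jet_equiv_sym[OF rep(2)[of p' q']]
          f smooth[OF rep(1)] by blast
    next
      assume "signed_jet_equiv r (p = p') (q = q') f f"
      then have "signed_jet_equiv r ((p = p') = p') ((q = q') = q') f (rep p' q')"
        using signed_jet_equiv_trans[OF _ rep(2)[of p' q']] f by blast
      \<comment> \<open>Multiplying twice by the same sign changes nothing.\<close>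
      moreover have "((p = p') = p') = p" "((q = q') = q') = q" by blast+
      ultimately show "A_isotopic r (rep p q) (rep p' q')"
        using iso_rep rep(1) by simp
    qed
    finally show ?thesis .
  qed
  have "A_isotopy_classes r f = range (\<lambda>(p, q). K p q)"
  proof (intro equalityI subsetI)
    fix X assume "X \<in> A_isotopy_classes r f"
    then obtain g where g: "A_equivalent f g" "X = R `` {g}"
      by (auto simp: A_isotopy_classes_def A_orbit_def R_def quotient_def)
    then obtain p q where "signed_jet_equiv r p q f g"
      using A_equivalent_imp_signed_jet_equiv by blast
    then have "X = K p q"
      unfolding K_def using class_eq[OF g(1)] iso_rep[OF g(1)] g(2) by blast
    then show "X \<in> range (\<lambda>(p, q). K p q)" by auto
  next
    fix X assume "X \<in> range (\<lambda>(p, q). K p q)"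
    then show "X \<in> A_isotopy_classes r f"
      using rep(1) by (auto simp: A_isotopy_classes_def A_orbit_def quotient_def K_def R_def)
  qed
  also have "\<dots> = {K True True, K True False, K False True, K False False}"
    by (auto simp: image_iff) (metis (full_types))+
  finally show "A_isotopy_classes r f = {K True True, K True False, K False True, K False False}" .
qed

text \<open>Orbit-stabiliser for the Klein four-group: the number of classes is 4 divided by the
  order of the stabiliser.\<close>

lemma card_A_isotopy_classes:
  fixes f :: "real^'n \<Rightarrow> real^'m"
  assumes "f \<in> smooth_germs" "1 \<le> r"
  shows "card (A_isotopy_classes r f) =
    (if signed_jet_equiv r False False f f
     then (if signed_jet_equiv r True False f f then 1 else 2)
     else if signed_jet_equiv r True False f f \<or> signed_jet_equiv r False True f f then 2 else 4)"
proof -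
  obtain K where K: "A_isotopy_classes r f = {K True True, K True False, K False True, K False False}"
    "\<And>p q p' q'. K p q = K p' q' \<longleftrightarrow> signed_jet_equiv r (p = p') (q = q') f f"
    using A_isotopy_classes_eq[OF assms] by metis
  have "signed_jet_equiv r False False f f \<Longrightarrow> signed_jet_equiv r True False f f \<Longrightarrow>
      signed_jet_equiv r False True f f"
    "signed_jet_equiv r False False f f \<Longrightarrow> signed_jet_equiv r False True f f \<Longrightarrow>
      signed_jet_equiv r True False f f"
    "signed_jet_equiv r True False f f \<Longrightarrow> signed_jet_equiv r False True f f \<Longrightarrow>
      signed_jet_equiv r False False f f"
    using signed_jet_equiv_trans[of r _ _ f f _ _ f] assms(1) by fastforce+
  note closed = this
  have eqs: "K True True = K True False \<longleftrightarrow> signed_jet_equiv r True False f f"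
    "K True True = K False True \<longleftrightarrow> signed_jet_equiv r False True f f"
    "K True True = K False False \<longleftrightarrow> signed_jet_equiv r False False f f"
    "K True False = K False True \<longleftrightarrow> signed_jet_equiv r False False f f"
    "K True False = K False False \<longleftrightarrow> signed_jet_equiv r False True f f"
    "K False True = K False False \<longleftrightarrow> signed_jet_equiv r True False f f"
    by (simp_all add: K(2))
  let ?FF = "signed_jet_equiv r False False f f" and ?TF = "signed_jet_equiv r True False f f"
    and ?FT = "signed_jet_equiv r False True f f"
  \<comment> \<open>Any two of the three nontrivial pairs generate the third, so the stabiliser is
    one of the five subgroups.\<close>
  consider "?FF" "?TF" "?FT" | "?FF" "\<not> ?TF" "\<not> ?FT" | "\<not> ?FF" "?TF" "\<not> ?FT"
    | "\<not> ?FF" "\<not> ?TF" "?FT" | "\<not> ?FF" "\<not> ?TF" "\<not> ?FT"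
    using closed by blast
  then show ?thesis
    unfolding K(1) by cases (simp_all add: card_insert_if eqs)
qed

section \<open>Jets of symmetries of the Morin normal form\<close>

lemma coord_less:
  assumes "1 \<le> i" "i < j" "j \<le> CARD('n)"
  shows "(coord i :: 'n::{finite,linorder}) < coord j"
proof -
  have "sorted_wrt (<) (sorted_list_of_set (UNIV :: 'n set))" by simp
  then show ?thesis
    unfolding coord_def by (rule sorted_wrt_nth_less) (use assms in auto)
qed

lemma coord_inject:
  assumes "1 \<le> i" "i \<le> CARD('n)" "1 \<le> j" "j \<le> CARD('n)"
  shows "(coord i :: 'n::{finite,linorder}) = coord j \<longleftrightarrow> i = j"
  using coord_less[of i j, where 'n='n] coord_less[of j i, where 'n='n] assms
  by (cases i j rule: linorder_cases) auto

lemma bij_betw_coord: "bij_betw coord {1..CARD('n)} (UNIV :: 'n::{finite,linorder} set)"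
proof -
  have "inj_on (coord :: nat \<Rightarrow> 'n) {1..CARD('n)}"
    by (auto simp: inj_on_def coord_inject)
  moreover from this have "coord ` {1..CARD('n)} = (UNIV :: 'n set)"
    by (intro card_subset_eq) (auto simp: card_image)
  ultimately show ?thesis by (simp add: bij_betw_def)
qed

lemma coord_cases:
  obtains i where "1 \<le> i" "i \<le> CARD('n)" "(x :: 'n::{finite,linorder}) = coord i"
proof -
  have "x \<in> coord ` {1..CARD('n)}"
    using bij_betw_coord[where 'n='n] by (simp add: bij_betw_def)
  then show ?thesis using that by auto
qed

lemma has_derivative_vec_lambda:
  fixes f :: "'a::real_normed_vector \<Rightarrow> 'n::finite \<Rightarrow> real"
  assumes "\<And>i. ((\<lambda>x. f x i) has_derivative (\<lambda>h. f' h i)) F"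
  shows "((\<lambda>x. \<chi> i. f x i) has_derivative (\<lambda>h. \<chi> i. f' h i)) F"
proof -
  have "(\<lambda>x. \<chi> i. f x i) = (\<lambda>x. \<Sum>i\<in>UNIV. f x i *\<^sub>R axis i 1)" 
    by (simp add: fun_eq_iff vec_eq_iff axis_def if_distrib cong: if_cong)
  moreover have "(\<lambda>h. \<chi> i. f' h i) = (\<lambda>h. \<Sum>i\<in>UNIV. f' h i *\<^sub>R axis i 1)" 
    by (simp add: fun_eq_iff vec_eq_iff axis_def if_distrib cong: if_cong)
  ultimately show ?thesis
    by (simp only:) (intro has_derivative_sum has_derivative_scaleR_left assms)
qed

definition morin_deriv :: "nat \<Rightarrow> real^'n::{finite,linorder} \<Rightarrow> real^'n::{finite,linorder} \<Rightarrow> real^'n::{finite,linorder}" where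
  "morin_deriv k x h = (\<chi> i. if i = coord 1
     then (\<Sum>j=2..k. (x $ coord 1) ^ (j - 1) * h $ coord j
            + real (j - 1) * (x $ coord 1) ^ (j - 2) * h $ coord 1 * x $ coord j)
          + real (k + 1) * (x $ coord 1) ^ k * h $ coord 1
     else h $ i)"

lemma has_derivative_morin_form:
  fixes x :: "real^'n::{finite,linorder}"
  shows "(morin_form k has_derivative morin_deriv k x) (at x)"
proof -
  have nth: "((\<lambda>x. x $ i) has_derivative (\<lambda>h. h $ i)) (at x)" for i :: 'n
    by (rule bounded_linear_imp_has_derivative) (rule bounded_linear_vec_nth)
  define P where "P = (\<lambda>x :: real^'n::{finite,linorder}. (\<Sum>j=2..k. (x $ coord 1) ^ (j - 1) * x $ coord j) + (x $ coord 1) ^ (k + 1))"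
  define P' where "P' = (\<lambda>h :: real^'n::{finite,linorder}. (\<Sum>j=2..k. (x $ coord 1) ^ (j - 1) * h $ coord j
            + real (j - 1) * (x $ coord 1) ^ (j - 2) * h $ coord 1 * x $ coord j)
          + real (k + 1) * (x $ coord 1) ^ k * h $ coord 1)"
  have "(P has_derivative (\<lambda>h. (\<Sum>j=2..k. (x $ coord 1) ^ (j - 1) * h $ coord j
            + (real (j - 1) * h $ coord 1 * (x $ coord 1) ^ (j - 1 - 1)) * x $ coord j)
          + real (k + 1) * h $ coord 1 * (x $ coord 1) ^ (k + 1 - 1))) (at x)"
    unfolding P_def
    by (intro has_derivative_add has_derivative_sum has_derivative_mult has_derivative_power nth)
  moreover have "(\<lambda>h. (\<Sum>j=2..k. (x $ coord 1) ^ (j - 1) * h $ coord j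
            + (real (j - 1) * h $ coord 1 * (x $ coord 1) ^ (j - 1 - 1)) * x $ coord j)
          + real (k + 1) * h $ coord 1 * (x $ coord 1) ^ (k + 1 - 1)) = P'"
    unfolding P'_def
    by (intro ext arg_cong2[of _ _ _ _ "(+)"] sum.cong) (auto simp: mult_ac diff_diff_add numeral_2_eq_2)
  ultimately have P: "(P has_derivative P') (at x)" by simp
  have "((\<lambda>x. if i = coord 1 then P x else x $ i) has_derivative
     (\<lambda>h. if i = coord 1 then P' h else h $ i)) (at x)" for i
    using P nth by (cases "i = coord 1") auto
  from has_derivative_vec_lambda[OF this] show ?thesis
    unfolding morin_form_def morin_deriv_def P_def P'_def .
qed

text \<open>In the Leibniz formula a permutation other than the identity moves its smallest
  non-fixed point upwards, so one factor lies above the diagonal and vanishes.\<close>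

lemma det_lower_triangular:
  fixes A :: "real^'n::{finite,linorder}^'n::{finite,linorder}"
  assumes "\<And>i j. i < j \<Longrightarrow> A $ i $ j = 0"
  shows "det A = (\<Prod>i\<in>UNIV. A $ i $ i)"
proof -
  have "of_int (sign p) * (\<Prod>i\<in>UNIV. A $ i $ p i) = (if p = id then \<Prod>i\<in>UNIV. A $ i $ i else 0)"
    if "p permutes UNIV" for p :: "'n \<Rightarrow> 'n"
  proof (cases "p = id")
    case False
    define i where "i = Min {i. p i \<noteq> i}"
    have "i \<in> {i. p i \<noteq> i}"
      unfolding i_def by (rule Min_in) (use False in auto)
    then have i: "p i \<noteq> i" by simp
    \<comment> \<open>The point p i is moved too, so the minimality of i applies to it.\<close>
    have "p (p i) \<noteq> p i"
      using i permutes_inj[OF that] by (auto dest: injD)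
    then have "i \<le> p i"
      unfolding i_def by (intro Min_le) auto
    then have "A $ i $ p i = 0" using assms i by simp
    then have "(\<Prod>i\<in>UNIV. A $ i $ p i) = 0"
      by (intro prod_zero) auto
    then show ?thesis using False by simp
  qed (simp add: sign_id)
  then have "det A = (\<Sum>p\<in>{p. p permutes (UNIV :: 'n set)}. if p = id then \<Prod>i\<in>UNIV. A $ i $ i else 0)"
    unfolding det_def by (intro sum.cong) auto
  also have "\<dots> = (\<Prod>i\<in>UNIV. A $ i $ i)"
    by (subst sum.delta) (simp_all add: permutes_id finite_permutations)
  finally show ?thesis .
qed

text \<open>Both determinants are their diagonal entry at i times the same complementary minor.
  Comparing the Leibniz sums term by term avoids forming that minor: a permutation that moves i
  contributes zero to either side.\<close>

lemma det_common_block: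
  fixes A C :: "real^'n^'n"
  assumes A: "\<And>j. j \<noteq> i \<Longrightarrow> A $ j $ i = 0" and C: "\<And>j. j \<noteq> i \<Longrightarrow> C $ i $ j = 0"
    and AC: "\<And>j l. j \<noteq> i \<Longrightarrow> l \<noteq> i \<Longrightarrow> A $ j $ l = C $ j $ l"
  shows "C $ i $ i * det A = A $ i $ i * det C"
proof -
  have "C $ i $ i * (\<Prod>j\<in>UNIV. A $ j $ p j) = A $ i $ i * (\<Prod>j\<in>UNIV. C $ j $ p j)"
    if p: "p permutes UNIV" for p :: "'n \<Rightarrow> 'n"
  proof (cases "p i = i")
    case True
    have "p j \<noteq> i" if "j \<noteq> i" for j
      using permutes_inj[OF p] True that by (metis injD)
    then have "(\<Prod>j\<in>UNIV - {i}. A $ j $ p j) = (\<Prod>j\<in>UNIV - {i}. C $ j $ p j)"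
      by (intro prod.cong refl AC) simp_all
    then show ?thesis
      using True by (simp add: prod.remove[of UNIV i])
  next
    case False
    obtain j where j: "p j = i" using permutes_surj[OF p] by (metis surjD)
    then have "A $ j $ p j = 0" using False A[of j] by (cases "j = i") simp_all
    then have "(\<Prod>j\<in>UNIV. A $ j $ p j) = 0" by (intro prod_zero) auto
    moreover have "(\<Prod>j\<in>UNIV. C $ j $ p j) = 0"
      using C[OF False] by (intro prod_zero) auto
    ultimately show ?thesis by (simp only: mult_zero_right)
  qed
  then show ?thesis
    unfolding det_def sum_distrib_left by (intro sum.cong) (auto simp: algebra_simps)
qed

section \<open>Orders of vanishing of real functions at 0\<close>

definition vanishes_to_order :: "nat \<Rightarrow> (real \<Rightarrow> real) \<Rightarrow> bool" where
  "vanishes_to_order p f \<longleftrightarrow> ((\<lambda>t. f t / t ^ p) \<longlongrightarrow> 0) (at 0)"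

lemma eventually_at_0_nonzero: "\<forall>\<^sub>F t in at (0::real). t \<noteq> 0"
  by (simp add: eventually_at_filter)

text \<open>\<open>vanishes_to_order p f\<close> means f = o(t^p), so any finite limit of f / t^p,
  zero or not, gives every smaller order.\<close>

lemma vanishes_to_order_limit:
  assumes "((\<lambda>t. f t / t ^ p) \<longlongrightarrow> L) (at 0)" "q < p"
  shows "vanishes_to_order q f"
proof -
  have "((\<lambda>t. f t / t ^ p * t ^ (p - q)) \<longlongrightarrow> L * 0 ^ (p - q)) (at (0::real))"
    by (intro tendsto_intros assms(1))
  moreover have "\<forall>\<^sub>F t in at 0. f t / t ^ p * t ^ (p - q) = f t / t ^ q"
    using eventually_at_0_nonzero by eventually_elim (use assms(2) in \<open>simp add: power_diff\<close>)
  ultimately show ?thesis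
    using assms(2) unfolding vanishes_to_order_def by (simp add: tendsto_cong power_0_left)
qed

lemma vanishes_to_order_mono: "vanishes_to_order p f \<Longrightarrow> q \<le> p \<Longrightarrow> vanishes_to_order q f"
  using vanishes_to_order_limit[of f p 0 q] by (cases "q = p") (auto simp: vanishes_to_order_def)

lemma vanishes_to_order_mult:
  assumes "vanishes_to_order p f" "(g \<longlongrightarrow> L) (at 0)"
  shows "vanishes_to_order p (\<lambda>t. f t * g t)"
  using tendsto_mult[OF assms[unfolded vanishes_to_order_def]]
  unfolding vanishes_to_order_def by (simp add: field_simps)

lemma vanishes_to_order_add:
  "vanishes_to_order p f \<Longrightarrow> vanishes_to_order p g \<Longrightarrow> vanishes_to_order p (\<lambda>t. f t + g t)"
  unfolding vanishes_to_order_def by (drule (1) tendsto_add) (simp add: add_divide_distrib)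

lemma vanishes_to_order_diff:
  "vanishes_to_order p f \<Longrightarrow> vanishes_to_order p g \<Longrightarrow> vanishes_to_order p (\<lambda>t. f t - g t)"
  unfolding vanishes_to_order_def by (drule (1) tendsto_diff) (simp add: diff_divide_distrib)

lemma vanishes_to_order_sum:
  "(\<And>i. i \<in> I \<Longrightarrow> vanishes_to_order p (f i)) \<Longrightarrow> vanishes_to_order p (\<lambda>t. \<Sum>i\<in>I. f i t)"
  unfolding vanishes_to_order_def sum_divide_distrib by (rule tendsto_null_sum)

lemma vanishes_to_order_cong:
  assumes "\<forall>\<^sub>F t in at 0. f t = g t" "vanishes_to_order p f"
  shows "vanishes_to_order p g"
proof -
  have "\<forall>\<^sub>F t in at 0. f t / t ^ p = g t / t ^ p"
    using assms(1) by eventually_elim simp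
  from tendsto_cong[OF this] show ?thesis
    using assms(2) unfolding vanishes_to_order_def by blast
qed

text \<open>Converts an O(t^(p+1)) bound, the shape of the Taylor estimates, into o(t^p).\<close>

lemma vanishes_to_orderI:
  assumes "\<forall>\<^sub>F t in at 0. \<bar>f t\<bar> \<le> K * \<bar>t\<bar> ^ Suc p"
  shows "vanishes_to_order p f"
  unfolding vanishes_to_order_def
proof (rule Lim_null_comparison)
  show "\<forall>\<^sub>F t in at 0. norm (f t / t ^ p) \<le> K * \<bar>t\<bar>"
    using assms eventually_at_0_nonzero
    by eventually_elim (simp add: power_abs field_simps)
  have "((\<lambda>t. K * \<bar>t\<bar>) \<longlongrightarrow> K * \<bar>0\<bar>) (at (0::real))"
    by (intro tendsto_intros)
  then show "((\<lambda>t. K * \<bar>t\<bar>) \<longlongrightarrow> 0) (at (0::real))" by simp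
qed

lemma tendsto_quotient_jac:
  fixes f :: "real^'n \<Rightarrow> real^'m"
  assumes "f \<in> smooth_germs"
  shows "((\<lambda>t. f (t *\<^sub>R v) $ i / t) \<longlongrightarrow> (jac f *v v) $ i) (at 0)"
proof -
  have d: "(f has_derivative (\<lambda>h. jac f *v h)) (at 0)"
    using assms smooth_near_differentiable[of 0 f]
    by (simp add: smooth_germs_iff jac_mult_vec frechet_derivative_works)
  have "((\<lambda>t. f (t *\<^sub>R v)) has_derivative (\<lambda>s. jac f *v (s *\<^sub>R v))) (at 0)"
    using diff_chain_at[OF bounded_linear_imp_has_derivative[OF bounded_linear_scaleR_left[of v], of "at 0"],
        of f "\<lambda>h. jac f *v h"] d
    by (simp add: comp_def)
  then have "((\<lambda>t. f (t *\<^sub>R v) $ i) has_derivative (\<lambda>s. (jac f *v (s *\<^sub>R v)) $ i)) (at 0)"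
    by (rule bounded_linear.has_derivative[OF bounded_linear_vec_nth])
  then have "((\<lambda>t. f (t *\<^sub>R v) $ i) has_field_derivative (jac f *v v) $ i) (at 0)"
    unfolding has_field_derivative_def
    by (simp add: matrix_vector_mult_scaleR mult.commute[of _ "(jac f *v v) $ i"])
  then show ?thesis
    unfolding DERIV_def using assms by (simp add: smooth_germs_iff)
qed

text \<open>A symmetry with the target map moved to the other side: in the application to
  \<open>signed_jet_equiv\<close>, R is inverse to its target map. Both sides agree up to
  O(|x|^(k+2)). Smoothness of the normal form is assumed here and later obtained from its being
  equivalent to a given germ.\<close>

locale morin_jet_symmetry =
  fixes k :: nat and S R :: "(real, 'n::{finite,linorder}) vec \<Rightarrow> (real, 'n) vec"
  assumes k: "1 \<le> k" "k \<le> CARD('n)"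
    and S: "S \<in> diffeo_germs" and R: "R \<in> diffeo_germs"
    and smooth_morin: "(morin_form k :: (real, 'n) vec \<Rightarrow> (real, 'n) vec) \<in> smooth_germs"
    and jets: "jet_eq (k + 1) (\<lambda>x. morin_form k (S x)) (\<lambda>x. R (morin_form k x))"
begin

definition i1 :: 'n where "i1 = coord 1"
abbreviation e1 :: "(real, 'n) vec" where "e1 \<equiv> axis i1 1"
definition a :: real where "a = jac S $ i1 $ i1"
definition c :: real where "c = jac R $ i1 $ i1"

lemma smooth_S: "S \<in> smooth_germs" and smooth_R: "R \<in> smooth_germs"
  using S R by (simp_all add: diffeo_germsD)

lemma coord_neq: "2 \<le> j \<Longrightarrow> j \<le> k \<Longrightarrow> coord j \<noteq> i1"
  using coord_inject[of j 1, where 'n='n] k by (auto simp: i1_def)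

lemma morin_form_nth:
  "morin_form k x $ i = (if i = i1
     then (\<Sum>j=2..k. (x $ i1) ^ (j - 1) * x $ coord j) + (x $ i1) ^ (k + 1) else x $ i)"
  by (simp add: morin_form_def i1_def)

lemma morin_deriv_nth:
  "morin_deriv k x h $ i = (if i = i1
     then (\<Sum>j=2..k. (x $ i1) ^ (j - 1) * h $ coord j
            + real (j - 1) * (x $ i1) ^ (j - 2) * h $ i1 * x $ coord j)
          + real (k + 1) * (x $ i1) ^ k * h $ i1
     else h $ i)"
  by (simp add: morin_deriv_def i1_def)

lemma jac_morin: "jac (morin_form k) $ i $ j = (if i = j then (if i = i1 then 0 else 1) else 0)"
proof -
  have "frechet_derivative (morin_form k) (at 0) = morin_deriv k (0 :: (real, 'n) vec)"
    using has_derivative_morin_form frechet_derivative_at by metis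
  then show ?thesis
    using k by (auto simp: jac_component morin_deriv_nth axis_def power_0_left intro!: sum.neutral)
qed

text \<open>The linear part of the normal form is the projection P along \<open>e1\<close>, and the
  first-order terms give P J_S = J_R P; the three claims are entries of this matrix
  identity.\<close>

lemma jac_blocks:
  shows "i \<noteq> i1 \<Longrightarrow> jac S $ i $ i1 = 0" and "j \<noteq> i1 \<Longrightarrow> jac R $ i1 $ j = 0"
    and "i \<noteq> i1 \<Longrightarrow> j \<noteq> i1 \<Longrightarrow> jac S $ i $ j = jac R $ i $ j"
proof -
  have "jac (\<lambda>x. morin_form k (S x)) = jac (\<lambda>x. R (morin_form k x))"
    by (rule jac_jet_eq[OF jets]) simp
  then have eq: "jac (morin_form k) ** jac S = jac R ** jac (morin_form k)"
    by (simp add: jac_compose smooth_S smooth_R smooth_morin)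
  have "(jac (morin_form k) ** jac S) $ i $ j = (if i \<noteq> i1 then jac S $ i $ j else 0)" for i j
    by (simp add: matrix_matrix_mult_def jac_morin if_distrib[of "\<lambda>x. x * _"] cong: if_cong)
  moreover have "(jac R ** jac (morin_form k)) $ i $ j = (if j \<noteq> i1 then jac R $ i $ j else 0)" for i j
    by (simp add: matrix_matrix_mult_def jac_morin if_distrib[of "\<lambda>x. _ * x"] cong: if_cong)
  ultimately have *: "(if i \<noteq> i1 then jac S $ i $ j else 0) = (if j \<noteq> i1 then jac R $ i $ j else 0)" for i j
    using eq by metis
  show "i \<noteq> i1 \<Longrightarrow> jac S $ i $ i1 = 0" using *[of i i1] by simp
  show "j \<noteq> i1 \<Longrightarrow> jac R $ i1 $ j = 0" using *[of i1 j] by simp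
  show "i \<noteq> i1 \<Longrightarrow> j \<noteq> i1 \<Longrightarrow> jac S $ i $ j = jac R $ i $ j" using *[of i j] by simp
qed

lemma a_nonzero: "a \<noteq> 0"
proof
  assume "a = 0"
  then have "column i1 (jac S) = 0"
    using jac_blocks(1) by (auto simp: column_def vec_eq_iff a_def) metis
  then show False using det_zero_column(2) det_jac_nonzero[OF S] by blast
qed

lemma morin_form_e1: "morin_form k (t *\<^sub>R e1) = t ^ (k + 1) *\<^sub>R e1"
  using coord_neq by (auto simp: morin_form_nth vec_eq_iff axis_def intro!: sum.neutral)

lemma tendsto_S: "((\<lambda>t. S (t *\<^sub>R e1) $ i / t) \<longlongrightarrow> jac S $ i $ i1) (at 0)"
  using tendsto_quotient_jac[OF smooth_S, of e1 i]
  by (simp add: matrix_vector_mult_basis column_def)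

lemma tendsto_S1: "((\<lambda>t. S (t *\<^sub>R e1) $ i1) \<longlongrightarrow> 0) (at 0)"
proof -
  have "((\<lambda>t. S (t *\<^sub>R e1) $ i1 / t * t) \<longlongrightarrow> jac S $ i1 $ i1 * 0) (at 0)"
    by (intro tendsto_mult tendsto_S tendsto_ident_at)
  moreover have "\<forall>\<^sub>F t in at 0. S (t *\<^sub>R e1) $ i1 / t * t = S (t *\<^sub>R e1) $ i1"
    using eventually_at_0_nonzero by eventually_elim simp
  ultimately show ?thesis by (simp add: tendsto_cong)
qed

lemma tendsto_S1_power: "((\<lambda>t. (S (t *\<^sub>R e1) $ i1) ^ p / t ^ p) \<longlongrightarrow> a ^ p) (at 0)"
  using tendsto_power[OF tendsto_S[of i1], of p] by (simp add: power_divide a_def)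

lemma tendsto_power_at: "filterlim (\<lambda>t::real. t ^ (k + 1)) (at 0) (at 0)"
proof -
  have "((\<lambda>t::real. t ^ (k + 1)) \<longlongrightarrow> 0 ^ (k + 1)) (at 0)"
    by (intro tendsto_intros)
  then show ?thesis
    unfolding filterlim_at using eventually_at_0_nonzero
    by (auto elim: eventually_mono)
qed

lemma vanishes_to_order_flat:
  fixes d :: "(real, 'n) vec \<Rightarrow> (real, 'n) vec"
  assumes "\<forall>\<^sub>F x in nhds 0. norm (d x) \<le> K * norm x ^ Suc p"
  shows "vanishes_to_order p (\<lambda>t. d (t *\<^sub>R e1) $ i)"
proof (rule vanishes_to_orderI)
  have "((\<lambda>t. t *\<^sub>R e1) \<longlongrightarrow> 0 *\<^sub>R e1) (at (0::real))"
    by (intro tendsto_intros)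
  then have "filterlim (\<lambda>t. t *\<^sub>R e1) (nhds 0) (at (0::real))" by simp
  from eventually_compose_filterlim[OF assms this]
  show "\<forall>\<^sub>F t in at 0. \<bar>d (t *\<^sub>R e1) $ i\<bar> \<le> K * \<bar>t\<bar> ^ Suc p"
    by eventually_elim (use component_le_norm_cart order_trans in fastforce)
qed

text \<open>Along the curve the two sides differ by O(t^(k+2)), negligible against t^(k+1), and R at
  t^(k+1) e1 is governed by column \<open>i1\<close> of its Jacobian.\<close>

lemma tendsto_morin_S:
  "((\<lambda>t. morin_form k (S (t *\<^sub>R e1)) $ i / t ^ (k + 1)) \<longlongrightarrow> jac R $ i $ i1) (at 0)"
proof -
  let ?d = "\<lambda>x. morin_form k (S x) - R (morin_form k x)"
  have "\<exists>K. \<forall>\<^sub>F x in nhds 0. norm (?d x) \<le> K * norm x ^ Suc (k + 1)"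
    using jet_eq_bound[OF smooth_germsD(2)[OF smooth_germs_compose[OF smooth_morin smooth_S]]
        smooth_germsD(2)[OF smooth_germs_compose[OF smooth_R smooth_morin]] jets] .
  then obtain K where "\<forall>\<^sub>F x in nhds 0. norm (?d x) \<le> K * norm x ^ Suc (k + 1)" ..
  then have "vanishes_to_order (k + 1) (\<lambda>t. ?d (t *\<^sub>R e1) $ i)"
    by (rule vanishes_to_order_flat)
  then have "((\<lambda>t. ?d (t *\<^sub>R e1) $ i / t ^ (k + 1)) \<longlongrightarrow> 0) (at 0)"
    by (simp add: vanishes_to_order_def)
  moreover have "((\<lambda>t. R (t ^ (k + 1) *\<^sub>R e1) $ i / t ^ (k + 1)) \<longlongrightarrow> (jac R *v e1) $ i) (at 0)"
    using filterlim_compose[OF tendsto_quotient_jac[OF smooth_R] tendsto_power_at] .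
  ultimately have "((\<lambda>t. ?d (t *\<^sub>R e1) $ i / t ^ (k + 1) + R (t ^ (k + 1) *\<^sub>R e1) $ i / t ^ (k + 1))
      \<longlongrightarrow> 0 + (jac R *v e1) $ i) (at 0)"
    by (rule tendsto_add)
  moreover have "?d (t *\<^sub>R e1) $ i / t ^ (k + 1) + R (t ^ (k + 1) *\<^sub>R e1) $ i / t ^ (k + 1)
      = morin_form k (S (t *\<^sub>R e1)) $ i / t ^ (k + 1)" for t
    unfolding morin_form_e1 vector_minus_component diff_divide_distrib by simp
  ultimately show ?thesis
    by (simp only: matrix_vector_mult_basis column_def vec_lambda_beta add_0)
qed

text \<open>The normal form leaves these components unchanged, so the source curve stays within
  O(t^(k+1)) of the kernel axis, closer than its tangent alone tells.\<close>

lemma tendsto_S_other: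
  "i \<noteq> i1 \<Longrightarrow> ((\<lambda>t. S (t *\<^sub>R e1) $ i / t ^ (k + 1)) \<longlongrightarrow> jac R $ i $ i1) (at 0)"
  using tendsto_morin_S[of i] by (simp add: morin_form_nth)

text \<open>Each mixed term is a positive power of the first component of S, which tends to 0, times
  a component of order t^(k+1); only the pure power contributes to the limit.\<close>

lemma c_eq: "c = a ^ (k + 1)"
proof -
  let ?s = "\<lambda>t i. S (t *\<^sub>R e1) $ i"
  have "((\<lambda>t. (\<Sum>j=2..k. ?s t i1 ^ (j - 1) * (?s t (coord j) / t ^ (k + 1))) + ?s t i1 ^ (k + 1) / t ^ (k + 1))
      \<longlongrightarrow> (\<Sum>j=2..k. 0 ^ (j - 1) * jac R $ coord j $ i1) + a ^ (k + 1)) (at 0)"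
    by (intro tendsto_add tendsto_sum tendsto_mult tendsto_power tendsto_S1 tendsto_S_other
        tendsto_S1_power coord_neq) auto
  moreover have "(\<Sum>j=2..k. 0 ^ (j - 1) * jac R $ coord j $ i1) = 0"
    by (intro sum.neutral) auto
  moreover have "((\<lambda>t. (\<Sum>j=2..k. ?s t i1 ^ (j - 1) * (?s t (coord j) / t ^ (k + 1))) + ?s t i1 ^ (k + 1) / t ^ (k + 1))
      \<longlongrightarrow> c) (at 0)"
    using tendsto_morin_S[of i1]
    by (simp add: morin_form_nth c_def add_divide_distrib sum_divide_distrib)
  ultimately show ?thesis using tendsto_unique[OF at_neq_bot] by fastforce
qed

lemma det_relation: "a ^ k * det (jac S) = det (jac R)"
proof -
  have "c * det (jac S) = a * det (jac R)"
    unfolding a_def c_def by (rule det_common_block) (auto intro: jac_blocks)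
  then show ?thesis using a_nonzero by (simp add: c_eq)
qed

lemma morin_deriv_e1:
  assumes "2 \<le> i" "i \<le> k"
  shows "morin_deriv k (t *\<^sub>R e1) (axis (coord i) 1) = t ^ (i - 1) *\<^sub>R e1 + axis (coord i) 1"
proof -
  have "(\<Sum>j=2..k. t ^ (j - 1) * (axis (coord i) 1 :: (real, 'n) vec) $ coord j) = (\<Sum>j=2..k. if j = i then t ^ (j - 1) else 0)"
    using assms k by (intro sum.cong) (auto simp: axis_def coord_inject)
  also have "\<dots> = t ^ (i - 1)" using assms by simp
  finally have s: "(\<Sum>j=2..k. t ^ (j - 1) * (axis (coord i) 1 :: (real, 'n) vec) $ coord j) = t ^ (i - 1)" .
  have "morin_deriv k (t *\<^sub>R e1) (axis (coord i) 1) $ i1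
      = (\<Sum>j=2..k. t ^ (j - 1) * (axis (coord i) 1 :: (real, 'n) vec) $ coord j)"
    unfolding morin_deriv_nth using coord_neq coord_neq[OF assms, THEN not_sym] assms
    by (auto simp: axis_def[of i1] axis_def[of "coord i"] intro!: sum.cong)
  with s show ?thesis
    using coord_neq[OF assms] coord_neq[OF assms, symmetric]
    by (simp add: vec_eq_iff) (simp add: axis_def morin_deriv_nth)
qed

text \<open>Differentiating the identity of jets in the direction of the \<open>i\<close>-th coordinate along the
  kernel direction and comparing orders in \<open>t\<close> shows that the Jacobian of \<open>R\<close> is triangular.\<close>

lemma derivative_along_e1:
  assumes i: "2 \<le> i" "i \<le> k"
  obtains w E F :: "real \<Rightarrow> 'n \<Rightarrow> real"
  where "\<forall>j. ((\<lambda>t. w t j) \<longlongrightarrow> jac S $ j $ coord i) (at 0)"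
    and "\<forall>j. ((\<lambda>t. E t j) \<longlongrightarrow> jac R $ j $ i1) (at 0)"
    and "\<forall>j. vanishes_to_order k (\<lambda>t. F t j - jac R $ j $ coord i)"
    and "\<forall>j. j \<noteq> i1 \<longrightarrow> vanishes_to_order k (\<lambda>t. w t j - (t ^ (i - 1) * E t j + F t j))"
    and "vanishes_to_order k (\<lambda>t. (\<Sum>j=2..k. (S (t *\<^sub>R e1) $ i1) ^ (j - 1) * w t (coord j)
            + real (j - 1) * (S (t *\<^sub>R e1) $ i1) ^ (j - 2) * w t i1 * S (t *\<^sub>R e1) $ coord j)
          + real (k + 1) * (S (t *\<^sub>R e1) $ i1) ^ k * w t i1 - (t ^ (i - 1) * E t i1 + F t i1))"
proof -
  define ei :: "(real, 'n) vec" where "ei = axis (coord i) 1"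
  have ei: "ei \<in> Basis" by (simp add: ei_def axis_in_Basis_iff)
  define y where "y t = t ^ (k + 1) *\<^sub>R e1" for t :: real
  \<comment> \<open>\<open>w\<close> is the derivative of S in direction \<open>ei\<close> along the
    axis; \<open>E\<close> and \<open>F\<close> are those of R in directions \<open>e1\<close> and
    \<open>ei\<close> at the image point y t. By the chain rule the identity compares the derivative
    of the normal form applied to w with t^(i-1) E + F.\<close>
  define w where "w t j = dderiv S ei (t *\<^sub>R e1) $ j" for t :: real and j
  define E where "E t j = dderiv R e1 (y t) $ j" for t j
  define F where "F t j = dderiv R ei (y t) $ j" for t j
  have curve: "filterlim (\<lambda>t. t *\<^sub>R e1) (nhds 0) (at (0::real))"
  proof -
    have "((\<lambda>t. t *\<^sub>R e1) \<longlongrightarrow> 0 *\<^sub>R e1) (at (0::real))" by (intro tendsto_intros)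
    then show ?thesis by simp
  qed
  have ylim: "filterlim y (nhds 0) (at (0::real))"
  proof -
    have "((\<lambda>t. t ^ (k + 1) *\<^sub>R e1) \<longlongrightarrow> 0 ^ (k + 1) *\<^sub>R e1) (at (0::real))" by (intro tendsto_intros)
    then show ?thesis by (simp add: y_def[abs_def])
  qed
  have cont: "((\<lambda>t. g (z t) $ j) \<longlongrightarrow> g 0 $ j) (at 0)"
    if "smooth_near 0 g" "filterlim z (nhds 0) (at (0::real))" for g :: "(real, 'n) vec \<Rightarrow> (real, 'n) vec" and z j
    using isCont_tendsto_compose[OF smooth_near_isCont[OF that(1)], of z "at 0"] that(2)
    by (intro tendsto_vec_nth)
  note smS = smooth_germsD(2)[OF smooth_S] and smR = smooth_germsD(2)[OF smooth_R]
  show ?thesis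
  proof (rule that[of w E F, OF allI allI allI allI[OF impI]])
    show "((\<lambda>t. w t j) \<longlongrightarrow> jac S $ j $ coord i) (at 0)" for j
      using cont[OF smooth_near_dderiv[OF smS, of ei] curve, of j]
      by (simp add: w_def jac_component ei_def)
    show "((\<lambda>t. E t j) \<longlongrightarrow> jac R $ j $ i1) (at 0)" for j
      using cont[OF smooth_near_dderiv[OF smR, of e1] ylim, of j]
      by (simp add: E_def jac_component)
    \<comment> \<open>As y t has size |t|^(k+1), a linear bound for the change of the derivative of
      R near 0 suffices.\<close>
    show "vanishes_to_order k (\<lambda>t. F t j - jac R $ j $ coord i)" for j
    proof -
      have "\<exists>K. \<forall>\<^sub>F x in nhds 0. norm (dderiv R ei x - dderiv R ei 0) \<le> K * norm x ^ Suc 0"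
        by (rule jet_eq_bound) (simp_all add: smooth_near_dderiv smR smooth_near_const jet_eq_0)
      then obtain K where "\<forall>\<^sub>F x in nhds 0. norm (dderiv R ei x - dderiv R ei 0) \<le> K * norm x ^ Suc 0" ..
      from eventually_compose_filterlim[OF this ylim]
      have "\<forall>\<^sub>F t in at 0. \<bar>F t j - jac R $ j $ coord i\<bar> \<le> K * \<bar>t\<bar> ^ Suc k"
      proof eventually_elim
        case (elim t)
        have "\<bar>F t j - jac R $ j $ coord i\<bar> = \<bar>(dderiv R ei (y t) - dderiv R ei 0) $ j\<bar>"
          by (simp add: F_def jac_component ei_def)
        also have "\<dots> \<le> norm (dderiv R ei (y t) - dderiv R ei 0)" by (rule component_le_norm_cart)
        also have "\<dots> \<le> K * \<bar>t\<bar> ^ Suc k" using elim by (simp add: y_def power_abs abs_mult)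
        finally show ?case .
      qed
      then show ?thesis by (rule vanishes_to_orderI)
    qed
    let ?d = "\<lambda>x. dderiv (\<lambda>x. morin_form k (S x)) ei x - dderiv (\<lambda>x. R (morin_form k x)) ei x"
    have smooth1: "smooth_near 0 (\<lambda>x. morin_form k (S x))"
      by (rule smooth_germsD(2)[OF smooth_germs_compose[OF smooth_morin smooth_S]])
    have smooth2: "smooth_near 0 (\<lambda>x. R (morin_form k x))"
      by (rule smooth_germsD(2)[OF smooth_germs_compose[OF smooth_R smooth_morin]])
    \<comment> \<open>Differentiating costs one order: the k-jets of the derivatives agree, hence
      the error is O(t^(k+1)) and vanishes to order k.\<close>
    have "jet_eq (Suc k) (\<lambda>x. morin_form k (S x)) (\<lambda>x. R (morin_form k x))"
      using jets by simp
    from jet_eq_bound[OF smooth_near_dderiv[OF smooth1] smooth_near_dderiv[OF smooth2]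
        jet_eq_SucD2[OF this ei]]
    obtain K where "\<forall>\<^sub>F x in nhds 0. norm (?d x) \<le> K * norm x ^ Suc k" ..
    then have van: "vanishes_to_order k (\<lambda>t. ?d (t *\<^sub>R e1) $ j)" for j
      by (rule vanishes_to_order_flat)
    have "\<forall>\<^sub>F t in at 0. ?d (t *\<^sub>R e1) = morin_deriv k (S (t *\<^sub>R e1)) (\<chi> j. w t j)
        - (\<chi> j. t ^ (i - 1) * E t j + F t j)"
      using eventually_compose_filterlim[OF smooth_near_eventually_differentiable[OF smS] curve]
        eventually_compose_filterlim[OF smooth_near_eventually_differentiable[OF smR] ylim]
    proof eventually_elim
      case (elim t)
      have "((\<lambda>x. morin_form k (S x)) has_derivative
          (\<lambda>h. morin_deriv k (S (t *\<^sub>R e1)) (frechet_derivative S (at (t *\<^sub>R e1)) h))) (at (t *\<^sub>R e1))"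
        using diff_chain_at[OF _ has_derivative_morin_form] elim(1)
        by (simp add: comp_def frechet_derivative_works)
      from frechet_derivative_at[OF this]
      have 1: "dderiv (\<lambda>x. morin_form k (S x)) ei (t *\<^sub>R e1)
          = morin_deriv k (S (t *\<^sub>R e1)) (\<chi> j. w t j)"
        unfolding w_def vec_nth_inverse by (rule fun_cong[OF sym])
      have R': "(R has_derivative frechet_derivative R (at (y t))) (at (morin_form k (t *\<^sub>R e1)))"
        unfolding morin_form_e1 y_def[symmetric] using elim(2) by (simp add: frechet_derivative_works)
      have lin: "linear (frechet_derivative R (at (y t)))"
        using elim(2) by (rule linear_frechet_derivative)
      have "((\<lambda>x. R (morin_form k x)) has_derivative
          (\<lambda>h. frechet_derivative R (at (y t)) (morin_deriv k (t *\<^sub>R e1) h))) (at (t *\<^sub>R e1))"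
        using diff_chain_at[OF has_derivative_morin_form R'] by (simp add: comp_def)
      from frechet_derivative_at[OF this]
      have "dderiv (\<lambda>x. R (morin_form k x)) ei (t *\<^sub>R e1)
          = frechet_derivative R (at (y t)) (t ^ (i - 1) *\<^sub>R e1 + ei)"
        unfolding morin_deriv_e1[OF i, symmetric] ei_def by (rule fun_cong[OF sym])
      also have "\<dots> = (\<chi> j. t ^ (i - 1) * E t j + F t j)"
        by (simp add: linear_add[OF lin] linear_cmul[OF lin] vec_eq_iff E_def F_def)
      finally show ?case using 1 by simp
    qed
    then have d: "\<forall>\<^sub>F t in at 0. ?d (t *\<^sub>R e1) $ j = morin_deriv k (S (t *\<^sub>R e1)) (\<chi> j. w t j) $ j
        - (t ^ (i - 1) * E t j + F t j)" for j
      by eventually_elim simp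
    show "vanishes_to_order k (\<lambda>t. w t j - (t ^ (i - 1) * E t j + F t j))" if "j \<noteq> i1" for j
      using vanishes_to_order_cong[OF d van, of j] that by (simp add: morin_deriv_nth)
    show "vanishes_to_order k (\<lambda>t. (\<Sum>j=2..k. (S (t *\<^sub>R e1) $ i1) ^ (j - 1) * w t (coord j)
            + real (j - 1) * (S (t *\<^sub>R e1) $ i1) ^ (j - 2) * w t i1 * S (t *\<^sub>R e1) $ coord j)
          + real (k + 1) * (S (t *\<^sub>R e1) $ i1) ^ k * w t i1 - (t ^ (i - 1) * E t i1 + F t i1))"
      using vanishes_to_order_cong[OF d van, of i1] by (simp add: morin_deriv_nth)
  qed
qed

text \<open>Divide the first component of the differentiated identity by t^(l-1), with s the first
  component of S on the curve. Terms s^(j-1) w_j with j > l are of higher order; for j < l the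
  induction hypothesis makes w_j of order t^(l-1), and s tends to 0. There remain s^(l-1) w_l, with
  limit a^(l-1) times the entry, and t^(i-1) E_1, with limit c if l = i and 0 if l < i.\<close>

lemma jac_R_triangular:
  assumes "2 \<le> l" "l \<le> i" "i \<le> k"
  shows "a ^ (l - 1) * jac R $ coord l $ coord i = (if l = i then c else 0)"
  using assms(1,2)
proof (induction l rule: less_induct)
  case (less l)
  have i: "2 \<le> i" "i \<le> k" using less.prems assms by auto
  obtain w E F :: "real \<Rightarrow> 'n \<Rightarrow> real"
    where w': "\<forall>j. ((\<lambda>t. w t j) \<longlongrightarrow> jac S $ j $ coord i) (at 0)"
    and E': "\<forall>j. ((\<lambda>t. E t j) \<longlongrightarrow> jac R $ j $ i1) (at 0)"
    and F': "\<forall>j. vanishes_to_order k (\<lambda>t. F t j - jac R $ j $ coord i)"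
    and wEF': "\<forall>j. j \<noteq> i1 \<longrightarrow> vanishes_to_order k (\<lambda>t. w t j - (t ^ (i - 1) * E t j + F t j))"
    and main: "vanishes_to_order k (\<lambda>t. (\<Sum>j=2..k. (S (t *\<^sub>R e1) $ i1) ^ (j - 1) * w t (coord j)
            + real (j - 1) * (S (t *\<^sub>R e1) $ i1) ^ (j - 2) * w t i1 * S (t *\<^sub>R e1) $ coord j)
          + real (k + 1) * (S (t *\<^sub>R e1) $ i1) ^ k * w t i1 - (t ^ (i - 1) * E t i1 + F t i1))"
    by (rule derivative_along_e1[OF i])
  note w = w'[rule_format] and E = E'[rule_format] and F = F'[rule_format] and wEF = wEF'[rule_format]
  define s where "s t = S (t *\<^sub>R e1) $ i1" for t
  have s0: "(s \<longlongrightarrow> 0) (at 0)" using tendsto_S1 by (simp add: s_def[abs_def])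
  have sp: "((\<lambda>t. s t ^ p / t ^ p) \<longlongrightarrow> a ^ p) (at 0)" for p
    using tendsto_S1_power by (simp add: s_def)
  have lk: "l - 1 < k" "l - 1 \<le> k" using less.prems i by auto
  \<comment> \<open>The factor \<open>0 ^ (i - l)\<close> is 1 if l = i and 0 if l < i; here the
    diagonal separates from the rest.\<close>
  have tE: "((\<lambda>t. t ^ (i - 1) * E t j / t ^ (l - 1)) \<longlongrightarrow> 0 ^ (i - l) * jac R $ j $ i1) (at 0)" for j
  proof -
    have "((\<lambda>t. t ^ (i - l) * E t j) \<longlongrightarrow> 0 ^ (i - l) * jac R $ j $ i1) (at 0)"
      by (intro tendsto_intros E)
    moreover have "\<forall>\<^sub>F t in at 0. t ^ (i - l) * E t j = t ^ (i - 1) * E t j / t ^ (l - 1)"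
      using eventually_at_0_nonzero
    proof eventually_elim
      case (elim t)
      have "i - 1 = (i - l) + (l - 1)" using less.prems by auto
      then have "t ^ (i - 1) = t ^ (i - l) * t ^ (l - 1)" by (simp only: power_add)
      then show ?case using elim by simp
    qed
    ultimately show ?thesis by (simp add: tendsto_cong)
  qed
  have coord_i: "coord i \<noteq> i1" using coord_neq i by simp
  \<comment> \<open>Row \<open>i1\<close> of \<open>jac R\<close> vanishes off the diagonal, so F_1
    has limit 0 and no constant term remains.\<close>
  have F1: "vanishes_to_order (l - 1) (\<lambda>t. F t i1)"
    using vanishes_to_order_mono[OF F[of i1] lk(2)] jac_blocks(2)[OF coord_i] by simp
  have others: "vanishes_to_order (l - 1) (\<lambda>t. s t ^ (j - 1) * w t (coord j))"
    if j: "2 \<le> j" "j \<le> k" "j \<noteq> l" for j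
  proof (cases "j < l")
    case True
    have "a ^ (j - 1) * jac R $ coord j $ coord i = 0"
      using less.IH[OF True] True less.prems j by simp
    then have z: "jac R $ coord j $ coord i = 0" using a_nonzero by simp
    \<comment> \<open>Splits w_j into its deviation from t^(i-1) E_j + F_j, the term t^(i-1) E_j,
      and the deviation of F_j from its limit, which is 0 by induction. Hence w_j / t^(l-1)
      converges.\<close>
    have "((\<lambda>t. (w t (coord j) - (t ^ (i - 1) * E t (coord j) + F t (coord j))) / t ^ (l - 1)
        + t ^ (i - 1) * E t (coord j) / t ^ (l - 1) + (F t (coord j) - jac R $ coord j $ coord i) / t ^ (l - 1))
        \<longlongrightarrow> 0 + 0 ^ (i - l) * jac R $ coord j $ i1 + 0) (at 0)"
      by (intro tendsto_add tE)
         (use vanishes_to_order_mono[OF wEF lk(2)] vanishes_to_order_mono[OF F lk(2)] coord_neq j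
           in \<open>auto simp: vanishes_to_order_def\<close>)
    then have "((\<lambda>t. w t (coord j) / t ^ (l - 1)) \<longlongrightarrow> 0 ^ (i - l) * jac R $ coord j $ i1) (at 0)"
      by (simp add: z flip: add_divide_distrib)
    then have "((\<lambda>t. s t ^ (j - 1) * (w t (coord j) / t ^ (l - 1)))
        \<longlongrightarrow> 0 ^ (j - 1) * (0 ^ (i - l) * jac R $ coord j $ i1)) (at 0)"
      by (intro tendsto_mult tendsto_power s0)
    then show ?thesis using j by (simp add: vanishes_to_order_def power_0_left)
  next
    case False
    then have "vanishes_to_order (l - 1) (\<lambda>t. s t ^ (j - 1))"
      using j less.prems by (intro vanishes_to_order_limit[OF sp]) auto
    then show ?thesis using vanishes_to_order_mult w by blast
  qed
  \<comment> \<open>These terms come from differentiating the powers of x_1; each carries a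
    component of S of order t^(k+1).\<close>
  have "vanishes_to_order (l - 1) (\<lambda>t. \<Sum>j=2..k. real (j - 1) * s t ^ (j - 2) * w t i1 * S (t *\<^sub>R e1) $ coord j)"
  proof (rule vanishes_to_order_sum)
    fix j assume j: "j \<in> {2..k}"
    have "vanishes_to_order (l - 1) (\<lambda>t. S (t *\<^sub>R e1) $ coord j)"
      using j lk coord_neq by (intro vanishes_to_order_limit[OF tendsto_S_other]) auto
    then have "vanishes_to_order (l - 1) (\<lambda>t. S (t *\<^sub>R e1) $ coord j * (real (j - 1) * s t ^ (j - 2) * w t i1))"
      by (rule vanishes_to_order_mult[OF _ tendsto_mult[OF tendsto_mult[OF tendsto_const tendsto_power[OF s0]] w]])
    then show "vanishes_to_order (l - 1) (\<lambda>t. real (j - 1) * s t ^ (j - 2) * w t i1 * S (t *\<^sub>R e1) $ coord j)"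
      by (simp add: mult_ac)
  qed
  note v1 = this
  have "vanishes_to_order (l - 1) (\<lambda>t. s t ^ k * (real (k + 1) * w t i1))"
    by (rule vanishes_to_order_mult[OF vanishes_to_order_limit[OF sp lk(1)] tendsto_mult[OF tendsto_const w]])
  then have v2: "vanishes_to_order (l - 1) (\<lambda>t. real (k + 1) * s t ^ k * w t i1)"
    by (simp only: mult.left_commute mult.assoc)
  have v3: "vanishes_to_order (l - 1) (\<lambda>t. \<Sum>j\<in>{2..k} - {l}. s t ^ (j - 1) * w t (coord j))"
    by (intro vanishes_to_order_sum others) auto
  have "vanishes_to_order (l - 1) (\<lambda>t. s t ^ (l - 1) * w t (coord l) - t ^ (i - 1) * E t i1)"
  proof (rule vanishes_to_order_cong[OF always_eventually[OF allI]])
    fix t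
    have "(\<Sum>j=2..k. s t ^ (j - 1) * w t (coord j)) =
        s t ^ (l - 1) * w t (coord l) + (\<Sum>j\<in>{2..k} - {l}. s t ^ (j - 1) * w t (coord j))"
      using less.prems i by (intro sum.remove) auto
    \<comment> \<open>Pure bookkeeping: X is the sum of all s^(j-1) w_j, x its term for l and Z the
      rest.\<close>
    moreover have "X + Y + C - (D + F') + F' - Y - C - Z = x - D" if "X = x + Z"
      for X Y C D F' Z x :: real
      using that by simp
    ultimately show "((\<Sum>j=2..k. (S (t *\<^sub>R e1) $ i1) ^ (j - 1) * w t (coord j)
            + real (j - 1) * (S (t *\<^sub>R e1) $ i1) ^ (j - 2) * w t i1 * S (t *\<^sub>R e1) $ coord j)
          + real (k + 1) * (S (t *\<^sub>R e1) $ i1) ^ k * w t i1 - (t ^ (i - 1) * E t i1 + F t i1))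
        + F t i1 - (\<Sum>j=2..k. real (j - 1) * s t ^ (j - 2) * w t i1 * S (t *\<^sub>R e1) $ coord j)
        - real (k + 1) * s t ^ k * w t i1 - (\<Sum>j\<in>{2..k} - {l}. s t ^ (j - 1) * w t (coord j))
      = s t ^ (l - 1) * w t (coord l) - t ^ (i - 1) * E t i1"
      unfolding sum.distrib s_def[symmetric] by blast
  qed (rule vanishes_to_order_diff[OF vanishes_to_order_diff[OF vanishes_to_order_diff[OF
            vanishes_to_order_add[OF vanishes_to_order_mono[OF main lk(2)] F1] v1] v2] v3])
  then have "((\<lambda>t. s t ^ (l - 1) / t ^ (l - 1) * w t (coord l) - t ^ (i - 1) * E t i1 / t ^ (l - 1)) \<longlongrightarrow> 0) (at 0)"
    by (simp add: vanishes_to_order_def diff_divide_distrib)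
  moreover have "((\<lambda>t. s t ^ (l - 1) / t ^ (l - 1) * w t (coord l) - t ^ (i - 1) * E t i1 / t ^ (l - 1))
      \<longlongrightarrow> a ^ (l - 1) * jac S $ coord l $ coord i - 0 ^ (i - l) * jac R $ i1 $ i1) (at 0)"
    by (intro tendsto_diff tendsto_mult sp w tE)
  ultimately have "a ^ (l - 1) * jac S $ coord l $ coord i - 0 ^ (i - l) * jac R $ i1 $ i1 = 0"
    using tendsto_unique[OF at_neq_bot] by blast
  \<comment> \<open>Away from \<open>i1\<close> the two Jacobians share their entries, so the
    relation for S becomes one for R.\<close>
  moreover have "jac S $ coord l $ coord i = jac R $ coord l $ coord i"
    using jac_blocks(3) coord_i coord_neq[of l] less.prems i by simp
  ultimately show ?case
    using less.prems by (auto simp: c_def power_0_left)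
qed

text \<open>The diagonal entries are a^(k+1) / a^(l-1) for l = 1, ..., k, and the subtracted
  exponents add up to k (k - 1) / 2. That power is kept on the left to avoid division.\<close>

lemma det_jac_R_full:
  assumes "k = CARD('n)"
  shows "det (jac R) * a ^ (k * (k - 1) div 2) = a ^ (k * (k + 1))"
proof -
  have tri: "jac R $ i $ j = 0" if "i < j" for i j
  proof -
    obtain l m where lm: "1 \<le> l" "l \<le> CARD('n)" "i = coord l" "1 \<le> m" "m \<le> CARD('n)" "j = coord m"
      by (metis coord_cases)
    have "l < m"
      using that coord_less[of m l, where 'n='n] lm by (cases l m rule: linorder_cases) auto
    show ?thesis
    proof (cases "l = 1")
      case True
      then show ?thesis using jac_blocks(2)[of j] that lm by (auto simp: i1_def)
    next
      case False
      then have "a ^ (l - 1) * jac R $ coord l $ coord m = 0"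
        using jac_R_triangular[of l m] lm \<open>l < m\<close> assms by simp
      then show ?thesis using a_nonzero lm by simp
    qed
  qed
  have diag: "jac R $ coord l $ coord l * a ^ (l - 1) = c" if "l \<in> {1..k}" for l
    using jac_R_triangular[of l l] that by (cases "l = 1") (auto simp: c_def i1_def mult.commute)
  have "det (jac R) = (\<Prod>i\<in>UNIV. jac R $ i $ i)"
    by (rule det_lower_triangular[OF tri])
  also have "\<dots> = (\<Prod>l\<in>{1..k}. jac R $ coord l $ coord l)"
    using prod.reindex_bij_betw[OF bij_betw_coord, of "\<lambda>i. jac R $ i $ i"] assms by simp
  finally have "det (jac R) * (\<Prod>l\<in>{1..k}. a ^ (l - 1)) = c ^ k"
    using diag by (simp flip: prod.distrib)
  moreover have "(\<Prod>l\<in>{1..k}. a ^ (l - 1)) = a ^ (\<Sum>l\<in>{1..k}. l - 1)"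
    by (simp add: power_sum)
  moreover have "(\<Sum>l\<in>{1..k}. l - 1) = k * (k - 1) div 2"
  proof -
    have "(\<Sum>l\<in>{1..k}. l - 1) = (\<Sum>l<k. l)"
      by (rule sum.reindex_bij_witness[of _ Suc "\<lambda>l. l - 1"]) auto
    then show ?thesis by (simp add: Sum_Ico_nat lessThan_atLeast0)
  qed
  moreover have "c ^ k = a ^ (k * (k + 1))"
    unfolding c_eq by (simp only: power_mult[symmetric] mult.commute)
  ultimately show ?thesis by simp
qed

end

text \<open>Passing from T to its inverse R turns invariance of the normal form into the two-sided
  identity of the locale without changing the sign of the determinant, and r-jets restrict to
  (k+1)-jets.\<close>

lemma signed_jet_equiv_morin_symmetry:
  assumes "1 \<le> k" "k \<le> CARD('n)" "k + 1 \<le> r"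
    and sm: "(morin_form k :: (real, 'n::{finite,linorder}) vec \<Rightarrow> (real, 'n::{finite,linorder}) vec) \<in> smooth_germs"
    and "signed_jet_equiv r p q (morin_form k :: (real, 'n) vec \<Rightarrow> (real, 'n) vec) (morin_form k)"
  obtains S R :: "(real, 'n::{finite,linorder}) vec \<Rightarrow> (real, 'n::{finite,linorder}) vec"
  where "morin_jet_symmetry k S R" "det (jac S) > 0 \<longleftrightarrow> p" "det (jac R) > 0 \<longleftrightarrow> q"
proof -
  let ?m = "morin_form k :: (real, 'n) vec \<Rightarrow> (real, 'n) vec"
  obtain S T where ST: "S \<in> diffeo_germs" "T \<in> diffeo_germs" "det (jac S) > 0 \<longleftrightarrow> p"
    "det (jac T) > 0 \<longleftrightarrow> q" "jet_eq r ?m (\<lambda>x. T (?m (S x)))"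
    by (rule signed_jet_equivE[OF assms(5)])
  obtain R where R: "R \<in> diffeo_germs" "\<forall>\<^sub>F x in nhds 0. R (T x) = x"
    by (rule diffeo_germsE[OF ST(2)])
  have smS: "(\<lambda>x. ?m (S x)) \<in> smooth_germs"
    by (rule smooth_germs_compose[OF sm diffeo_germsD(1)[OF ST(1)]])
  have smT: "(\<lambda>x. T (?m (S x))) \<in> smooth_germs"
    by (rule smooth_germs_compose[OF diffeo_germsD(1)[OF ST(2)] smS])
  have "jet_eq r (\<lambda>x. R (?m x)) (\<lambda>x. R (T (?m (S x))))"
    by (rule jet_eq_compose_germs[OF sm smT id_diffeo_germ R(1) ST(5)])
  moreover have "jet_eq r (\<lambda>x. R (T (?m (S x)))) (\<lambda>x. ?m (S x))"
    by (rule jet_eq_eventually[OF eventually_nhds_0_compose[OF smS R(2)]])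
  ultimately have "jet_eq r (\<lambda>x. ?m (S x)) (\<lambda>x. R (?m x))"
    by (rule jet_eq_sym[OF jet_eq_trans])
  then have "morin_jet_symmetry k S R"
    unfolding morin_jet_symmetry_def using assms ST(1) R(1) jet_eq_mono by blast
  moreover have "det (jac R) > 0 \<longleftrightarrow> q"
    using det_jac_inverse[OF ST(2) R] ST(4)
    by (metis zero_less_mult_pos zero_less_mult_pos2 zero_less_one)
  ultimately show ?thesis using ST(3) by (intro that)
qed

section \<open>Explicit symmetries of the normal form\<close>

lemma flip_mult_vec: "(flip N *v x) $ i = (if i \<in> N then - x $ i else x $ i)"
  by (simp add: flip_def matrix_vector_mult_def if_distrib[of "\<lambda>c. c * _"] cong: if_cong)

text \<open>A flip is its own inverse, so intertwining f with itself amounts to fixing f.\<close>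

lemma signed_jet_equiv_flip:
  assumes "\<And>x. f (flip M *v x) = flip N *v f x"
  shows "signed_jet_equiv r (det (flip M) > 0) (det (flip N) > 0) f f"
proof (rule signed_jet_equivI[OF flip_diffeo_germ flip_diffeo_germ])
  show "jet_eq r f (\<lambda>x. flip N *v f (flip M *v x))"
    by (simp add: assms matrix_vector_mul_assoc flip_mult flip_empty jet_eq_refl)
qed (simp_all add: jac_matrix)

text \<open>The normal form is quasi-homogeneous: with weight 1 for x_1 and k + 2 - j for x_j, 2 <=
  j <= k, its first component has weight k + 1. Scaling by -1 reverses the coordinates of odd
  weight; in the target, position 1 has weight k + 1, whence the uniform condition
  \<open>odd (k + j)\<close>.\<close>

definition morin_target_flip :: "nat \<Rightarrow> 'n::{finite,linorder} set" where
  "morin_target_flip k = coord ` {j \<in> {1..k}. odd (k + j)}"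

text \<open>In the source the first coordinate has weight 1 and is reversed for every k, so it is
  treated apart.\<close>

definition morin_source_flip :: "nat \<Rightarrow> 'n::{finite,linorder} set" where
  "morin_source_flip k = insert (coord 1) (coord ` {j \<in> {2..k}. odd (k + j)})"

lemma coord_in_flips:
  assumes "k \<le> CARD('n)" "1 \<le> j" "j \<le> k"
  shows "(coord j :: 'n::{finite,linorder}) \<in> morin_target_flip k \<longleftrightarrow> odd (k + j)"
    and "(coord j :: 'n::{finite,linorder}) \<in> morin_source_flip k \<longleftrightarrow> j = 1 \<or> odd (k + j)"
proof -
  have inj: "(coord j :: 'n) = coord l \<longleftrightarrow> j = l" if "1 \<le> l" "l \<le> k" for l
    using that assms by (intro coord_inject) auto
  show "(coord j :: 'n) \<in> morin_target_flip k \<longleftrightarrow> odd (k + j)"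
    unfolding morin_target_flip_def using assms by (auto simp: inj)
  show "(coord j :: 'n) \<in> morin_source_flip k \<longleftrightarrow> j = 1 \<or> odd (k + j)"
    unfolding morin_source_flip_def using assms inj[of 1] by (auto simp: inj)
qed

lemma morin_form_flip:
  fixes x :: "(real, 'n::{finite,linorder}) vec"
  assumes k: "1 \<le> k" "k \<le> CARD('n)"
  shows "morin_form k (flip (morin_source_flip k) *v x) = flip (morin_target_flip k) *v morin_form k x"
proof -
  let ?S = "morin_source_flip k :: 'n set" and ?T = "morin_target_flip k :: 'n set"
  have "morin_form k (flip ?S *v x) $ i = (flip ?T *v morin_form k x) $ i" for i
  proof (cases "i = coord 1")
    case True
    have 1: "coord 1 \<in> ?S" "coord 1 \<in> ?T \<longleftrightarrow> odd (k + 1)"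
      using coord_in_flips[of k 1, where 'n='n] k by auto
    \<comment> \<open>All monomials have weight k + 1, so the sign does not depend on j: j - 1
      factors -1 come from the power and possibly one from coordinate j.\<close>
    have sign: "(- y) ^ (j - 1) * (flip ?S *v x) $ coord j = (-1) ^ (k + 1) * (y ^ (j - 1) * x $ coord j)"
      if j: "j \<in> {2..k}" for j and y :: real
    proof -
      have "coord j \<in> ?S \<longleftrightarrow> odd (k + j)"
        using coord_in_flips(2)[of k j, where 'n='n] k j by auto
      moreover obtain l where "j = Suc l" using j by (cases j) auto
      ultimately show ?thesis
        by (auto simp: flip_mult_vec power_minus[of y])
    qed
    have c1: "(flip ?S *v x) $ coord 1 = - (x $ coord 1)"
      using 1(1) by (simp only: flip_mult_vec if_True)
    have "morin_form k (flip ?S *v x) $ coord 1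
        = (\<Sum>j=2..k. (- (x $ coord 1)) ^ (j - 1) * (flip ?S *v x) $ coord j) + (- (x $ coord 1)) ^ (k + 1)"
      by (simp only: morin_form_def vec_lambda_beta simp_thms if_True c1)
    also have "\<dots> = (\<Sum>j=2..k. (-1) ^ (k + 1) * ((x $ coord 1) ^ (j - 1) * x $ coord j))
        + (-1) ^ (k + 1) * (x $ coord 1) ^ (k + 1)"
      by (simp only: sum.cong[OF refl sign] power_minus[of "x $ coord 1" "k + 1"])
    also have "\<dots> = (-1) ^ (k + 1) * morin_form k x $ coord 1"
      by (simp only: morin_form_def vec_lambda_beta simp_thms if_True sum_distrib_left distrib_left)
    finally have "morin_form k (flip ?S *v x) $ i = (-1) ^ (k + 1) * morin_form k x $ i"
      using True by simp
    then show ?thesis using True 1(2) by (auto simp: flip_mult_vec)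
  next
    case False
    have "i \<in> ?S \<longleftrightarrow> i \<in> ?T"
    proof -
      have "{j \<in> {1..k}. odd (k + j)} - {1} = {j \<in> {2..k}. odd (k + j)}" by auto
      then show ?thesis
        unfolding morin_source_flip_def morin_target_flip_def using False by auto
    qed
    then show ?thesis using False by (simp add: morin_form_def flip_mult_vec)
  qed
  then show ?thesis by (simp add: vec_eq_iff)
qed

lemma morin_form_flip_trivial:
  fixes x :: "(real, 'n::{finite,linorder}) vec"
  assumes k: "1 \<le> k" "k < CARD('n)"
  shows "morin_form k (flip {coord (k + 1)} *v x) = flip {coord (k + 1)} *v morin_form k x"
proof -
  have neq: "coord j \<noteq> (coord (k + 1) :: 'n)" if "1 \<le> j" "j \<le> k" for j
    using coord_inject[of j "k + 1", where 'n='n] that k by auto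
  have "(\<Sum>j=2..k. (x $ coord 1) ^ (j - 1) * (flip {coord (k + 1)} *v x) $ coord j)
      = (\<Sum>j=2..k. (x $ coord 1) ^ (j - 1) * x $ coord j)"
    using neq by (intro sum.cong) (auto simp: flip_mult_vec)
  then show ?thesis
    using neq[of 1] k by (auto simp: vec_eq_iff morin_form_def flip_mult_vec)
qed

text \<open>As an instance of the locale, the flips get their orientations from the general formulas
  with a = -1, in place of a count of the reversed coordinates.\<close>

lemma morin_jet_symmetry_flip:
  assumes "1 \<le> k" "k \<le> CARD('n)"
    and "(morin_form k :: (real, 'n::{finite,linorder}) vec \<Rightarrow> (real, 'n::{finite,linorder}) vec) \<in> smooth_germs"
  shows "morin_jet_symmetry k (\<lambda>x. flip (morin_source_flip k) *v x)
    (\<lambda>x. flip (morin_target_flip k) *v x :: (real, 'n::{finite,linorder}) vec)"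
  unfolding morin_jet_symmetry_def morin_form_flip[OF assms(1,2)]
  by (intro conjI assms flip_diffeo_germ jet_eq_refl)

section \<open>Orientation signs of symmetries and the final count\<close>

context morin_jet_symmetry
begin

lemma det_jac_same_sign: "even k \<Longrightarrow> det (jac S) > 0 \<longleftrightarrow> det (jac R) > 0"
  using a_nonzero by (simp add: zero_less_mult_iff zero_less_power_eq flip: det_relation)

text \<open>The exponent k (k + 1) is even, so det R has the sign of a^(k (k - 1) / 2), and det S
  differs from it by the sign of a^k.\<close>

lemma det_jac_signs_full:
  assumes "k = CARD('n)"
  shows "det (jac R) > 0 \<longleftrightarrow> a > 0 \<or> even (k * (k - 1) div 2)"
    and "det (jac S) > 0 \<longleftrightarrow> a > 0 \<or> (even k \<longleftrightarrow> even (k * (k - 1) div 2))"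
proof -
  define e where "e = k * (k - 1) div 2"
  have "det (jac R) * a ^ e > 0"
    unfolding e_def det_jac_R_full[OF assms] using a_nonzero by (simp add: zero_less_power_eq)
  then show R: "det (jac R) > 0 \<longleftrightarrow> a > 0 \<or> even (k * (k - 1) div 2)"
    using a_nonzero unfolding e_def[symmetric]
    by (auto simp: zero_less_mult_iff zero_less_power_eq power_less_zero_eq)
  have "a ^ k * det (jac S) > 0 \<longleftrightarrow> det (jac R) > 0" "a ^ k * det (jac S) \<noteq> 0"
    using det_jac_nonzero[OF S] a_nonzero by (simp_all add: det_relation[symmetric])
  then show "det (jac S) > 0 \<longleftrightarrow> a > 0 \<or> (even k \<longleftrightarrow> even (k * (k - 1) div 2))"
    using a_nonzero unfolding R
    by (auto simp: zero_less_mult_iff zero_less_power_eq power_less_zero_eq)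
qed

end

text \<open>For k = 2p the number k (k - 1) / 2 is p (2p - 1), which has the parity of p. This is
  where divisibility by 4 enters.\<close>

lemma four_dvd_iff:
  assumes "1 \<le> (k::nat)"
  shows "4 dvd k \<longleftrightarrow> even k \<and> even (k * (k - 1) div 2)"
proof (cases "even k")
  case True
  then obtain p where p: "k = 2 * p" by blast
  then have "k * (k - 1) div 2 = p * (2 * p - 1)" by simp
  moreover have "odd (2 * p - 1)" using p assms by simp
  ultimately have "even (k * (k - 1) div 2) \<longleftrightarrow> even p" by simp
  moreover have "4 dvd k \<longleftrightarrow> even p" unfolding p by presburger
  ultimately show ?thesis using True by simp
next
  case False
  then show ?thesis by (auto elim: dvd_trans[rotated])
qed

text \<open>The case a = -1. For odd k the relation det R = a^k det S makes the two signs opposite,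
  as needed for k < n; for k = n the exact signs are recorded.\<close>

lemma signed_jet_equiv_morin_flip:
  assumes "1 \<le> k" "k \<le> CARD('n)"
    and sm: "(morin_form k :: (real, 'n::{finite,linorder}) vec \<Rightarrow> (real, 'n::{finite,linorder}) vec) \<in> smooth_germs"
  shows "\<exists>p q. signed_jet_equiv r p q (morin_form k :: (real, 'n) vec \<Rightarrow> (real, 'n) vec) (morin_form k) \<and>
    (odd k \<longrightarrow> p \<noteq> q) \<and>
    (k = CARD('n) \<longrightarrow> p = (even k = even (k * (k - 1) div 2)) \<and> q = even (k * (k - 1) div 2))"
proof -
  let ?S = "flip (morin_source_flip k) :: ((real, 'n) vec, 'n) vec" and ?T = "flip (morin_target_flip k) :: ((real, 'n) vec, 'n) vec"
  interpret morin_jet_symmetry k "\<lambda>x. ?S *v x" "\<lambda>x. ?T *v x"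
    by (rule morin_jet_symmetry_flip[OF assms])
  have a: "a = -1"
    unfolding a_def jac_matrix i1_def by (simp add: flip_def morin_source_flip_def)
  have "odd k \<Longrightarrow> (det ?S > 0) \<noteq> (det ?T > 0)"
    using det_relation det_jac_nonzero[OF S] unfolding a jac_matrix by auto
  moreover have "signed_jet_equiv r (det ?S > 0) (det ?T > 0) (morin_form k :: (real, 'n) vec \<Rightarrow> (real, 'n) vec) (morin_form k)"
    by (rule signed_jet_equiv_flip[where f="morin_form k"]) (rule morin_form_flip[OF assms(1,2)])
  moreover note det_jac_signs_full[unfolded a jac_matrix]
  ultimately show ?thesis by auto
qed

lemma A_isotopy_classes_cong:
  fixes f g :: "real^'n \<Rightarrow> real^'m"
  shows "A_equivalent f g \<Longrightarrow> A_isotopy_classes r f = A_isotopy_classes r g"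
  by (simp add: A_isotopy_classes_def A_orbit_eq)

(* A k-Morin singularity is (k+1)-determined; hence so are all germs in its orbit, and they
   are r-determined for every r >= k+1.  The count holds for isotopy at each such jet level. *)
theorem mainTheorem1:
  fixes f :: "real^'n::{finite,linorder} \<Rightarrow> real^'n::{finite,linorder}"
  shows "(morin CARD('n) f \<longrightarrow>
            (\<forall>r \<ge> CARD('n) + 1.
               card (A_isotopy_classes r f) = (if 4 dvd CARD('n) then 4 else 2))) \<and>
         (\<forall>k. 1 \<le> k \<and> k < CARD('n) \<and> morin k f \<longrightarrow>
            (\<forall>r \<ge> k + 1.
               card (A_isotopy_classes r f) = (if even k then 2 else 1)))"
proof (intro conjI impI allI)
  fix r assume f: "morin CARD('n) f" and r: "CARD('n) + 1 \<le> r"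
  define k where "k = CARD('n)"
  define e where "e = k * (k - 1) div 2"
  let ?m = "morin_form k :: (real, 'n) vec \<Rightarrow> (real, 'n) vec"
  have k: "1 \<le> k" "k \<le> CARD('n)" "k + 1 \<le> r" "1 \<le> r"
    using f r by (auto simp: morin_def k_def)
  have fm: "A_equivalent f ?m" using f by (simp add: morin_def k_def)
  note sm = A_equivalent_smooth(2)[OF fm]
  \<comment> \<open>Positive a gives the trivial pair and negative a the single pair computed from k
    and e, so the stabiliser has at most two elements.\<close>
  have upper: "p \<and> q \<or> p = (even k = even e) \<and> q = even e"
    if pq: "signed_jet_equiv r p q ?m ?m" for p q
  proof -
    obtain S R :: "(real, 'n) vec \<Rightarrow> (real, 'n) vec"
      where "morin_jet_symmetry k S R" and signs: "det (jac S) > 0 \<longleftrightarrow> p" "det (jac R) > 0 \<longleftrightarrow> q"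
      by (rule signed_jet_equiv_morin_symmetry[OF k(1-3) sm pq])
    then interpret morin_jet_symmetry k S R by simp
    show ?thesis
      using det_jac_signs_full[OF k_def] signs unfolding e_def by auto
  qed
  have "signed_jet_equiv r (even k = even e) (even e) ?m ?m"
    using signed_jet_equiv_morin_flip[OF k(1,2) sm, of r] unfolding e_def by (auto simp: k_def)
  then have lower: "signed_jet_equiv r p q ?m ?m" if "p = (even k = even e)" "q = even e" for p q
    using that by simp
  \<comment> \<open>The symmetry with a = -1 has signs (+,+) exactly if k and e are even; only then
    is the stabiliser trivial.\<close>
  have "4 dvd k \<longleftrightarrow> even k \<and> even e"
    unfolding e_def by (rule four_dvd_iff[OF k(1)])
  then show "card (A_isotopy_classes r f) = (if 4 dvd CARD('n) then 4 else 2)"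
    unfolding A_isotopy_classes_cong[OF fm] card_A_isotopy_classes[OF sm k(4)] k_def[symmetric]
    using upper[of False False] upper[of True False] upper[of False True]
      lower[of False False] lower[of True False] lower[of False True]
    by (cases "even k"; cases "even e") auto
next
  fix k r assume f: "1 \<le> k \<and> k < CARD('n) \<and> morin k f" and r: "k + 1 \<le> r"
  let ?m = "morin_form k :: (real, 'n) vec \<Rightarrow> (real, 'n) vec"
  have k: "1 \<le> k" "k \<le> CARD('n)" "k + 1 \<le> r" "1 \<le> r" "k < CARD('n)"
    using f r by auto
  have fm: "A_equivalent f ?m" using f by (simp add: morin_def)
  note sm = A_equivalent_smooth(2)[OF fm]
  \<comment> \<open>Coordinate k + 1 exists because k < n; it is reversed in source and
    target.\<close>
  have FF: "signed_jet_equiv r False False ?m ?m"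
    using signed_jet_equiv_flip[where f="?m", OF morin_form_flip_trivial[OF k(1,5)], of r]
    by (simp add: det_flip)
  \<comment> \<open>Given the pair (-,-), this decides between stabilisers of order two and four.
    For even k the factor a^k is positive and forces equal signs.\<close>
  have TF: "signed_jet_equiv r True False ?m ?m \<longleftrightarrow> odd k"
  proof
    assume TF: "signed_jet_equiv r True False ?m ?m"
    obtain S R :: "(real, 'n) vec \<Rightarrow> (real, 'n) vec"
      where "morin_jet_symmetry k S R" and pq: "det (jac S) > 0 \<longleftrightarrow> True" "det (jac R) > 0 \<longleftrightarrow> False"
      by (rule signed_jet_equiv_morin_symmetry[OF k(1-3) sm TF])
    then interpret morin_jet_symmetry k S R by simp
    show "odd k" using det_jac_same_sign pq by auto
  next
    assume "odd k"
    then obtain p q where "signed_jet_equiv r p q ?m ?m" "p \<noteq> q"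
      using signed_jet_equiv_morin_flip[OF k(1,2) sm, of r] by blast
    then have "signed_jet_equiv r p (\<not> p) ?m ?m" by (cases p; cases q) simp_all
    \<comment> \<open>If the pair found is (-,+), composing with (-,-) turns it into (+,-).\<close>
    then show "signed_jet_equiv r True False ?m ?m"
      using signed_jet_equiv_trans[OF FF, of p "\<not> p" ?m] sm by (cases p) auto
  qed
  show "card (A_isotopy_classes r f) = (if even k then 2 else 1)"
    unfolding A_isotopy_classes_cong[OF fm] card_A_isotopy_classes[OF sm k(4)] using FF TF by simp
qed

end
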